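(* Let $X$ be an (unbounded) nested fractal, regarded as a sub-Gaussian Dirichlet space with parameters $d_H,d_W$. Then $\mathbf B^{1,d_H/d_W}(X)$ contains the indicator functions of all cells with finite boundary, and so is dense in $L^1(X,\mu)$. Hence $\alpha_1^*=d_H/d_W$.
   Context: A sub-Gaussian Dirichlet space $(X,d,\mu,\mathcal E,\mathcal F)$ with parameters $d_H,d_W$ means: $(X,d,\mu)$ is a locally compact metric measure space, $\mu$ is a Radon measure with support $X$, $(\mathcal E,\mathcal F)$ is a Dirichlet form on $L^2(X,\mu)$, and (i) every ball $B(x,r)=\{y: d(x,y)<r\}$, $x\in X$, $0<r<\infty$, has compact closure; (ii) $\mu$ is Ahlfors $d_H$-regular: there are $c_1,c_2,d_H\in(0,\infty)$ with $c_1r^{d_H}\le\mu(B(x,r))\le c_2r^{d_H}$ for all $x\in X$, $r\in[0,\infty)$; (iii) $\mathcal E$ is regular and strongly local (i.e. $\mathcal E(u,v)=0$ for $u,v\in\mathcal F$ with compact supports such that $u$ is constant in a neighborhood of the support of $v$); (iv) the heat semigroup $\{P_t\}$ of $(\mathcal E,\mathcal F)$ has a continuous heat kernel $p_t(x,y)$ satisfying, for some $c_3,c_4,c_5,c_6\in(0,\infty)$ and $d_W\in(2,\infty)$, $$c_5t^{-d_H/d_W}\exp\Big(-c_6\Big(\tfrac{d(x,y)^{d_W}}{t}\Big)^{\frac1{d_W-1}}\Big)\le p_t(x,y)\le c_3t^{-d_H/d_W}\exp\Big(-c_4\Big(\tfrac{d(x,y)^{d_W}}{t}\Big)^{\frac1{d_W-1}}\Big)$$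 for $\mu\times\mu$-a.e. $(x,y)$ and all $t>0$. In this setting $P_t1=1$. Nested fractals (Lindstrøm). Let $\psi_1,\dots,\psi_M$ ($M\ge2$) be similitudes of $\mathbb R^D$ with common contraction ratio $1/L$, $L>1$, satisfying the open set condition, and let $K$ be the unique nonempty compact set with $K=\bigcup_i\psi_i(K)$. A fixed point $x$ of some $\psi_k$ is essential if there are another fixed point $y$ of one of the maps and $i\ne j$ with $\psi_i(x)=\psi_j(y)$; let $V_0$ be the set of essential fixed points. For a word $w=w_1\cdots w_m$ write $\psi_w=\psi_{w_1}\circ\cdots\circ\psi_{w_m}$. $K$ is a (compact) nested fractal if: $|V_0|\ge2$; (connectivity) the graph on $\bigcup_i\psi_i(V_0)$ joining points lying in a common $\psi_i(V_0)$ is connected; (symmetry) for $x\ne y$ in $V_0$ the reflection in the hyperplane bisecting $[x,y]$ maps, for each $m$, sets $\psi_w(V_0)$ with $|w|=m$ to sets of the same form; (nesting) for distinct words $w,w'$ of equal length $\psi_w(K)\cap\psi_{w'}(K)=\psi_w(V_0)\cap\psi_{w'}(V_0)$. Normalizing so that $\psi_1(x)=x/L$ with $0\in V_0$, the unbounded nested fractal is $X=\bigcup_{m\ge0}L^mK$; its cells are the sets $L^m\psi_w(K)$ (with finite set of boundary points contained in $L^m\psi_w(V_0)$). $X$ carries the self-similar measure $\mu$ (giving equal mass to cells of equal size) and a geodesic metric $d$ inducing the Euclidean topology, for which $(X,d,\mu)$ together with the Dirichlet form of Lindstrøm's Brownian motion is a sub-Gaussian Dirichlet space with $1\le d_H<d_W$,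 and $(X,d,\mu)$ is a fractional metric space (complete, Ahlfors $d_H$-regular, geodesic). Examples: unbounded Sierpinski gasket, unbounded Vicsek set. For $\alpha\ge0$, $\|f\|_{1,\alpha}=\sup_{t>0}t^{-\alpha}\int_X\int_X|f(x)-f(y)|p_t(x,y)\,d\mu(x)\,d\mu(y)$, $\mathbf B^{1,\alpha}(X)=\{f\in L^1(X,\mu):\|f\|_{1,\alpha}<\infty\}$, and $\alpha_1^*=\sup\{\alpha>0:\mathbf B^{1,\alpha}(X)\text{ is dense in }L^1(X,\mu)\}$. *)

theory Defs
  imports "HOL-Analysis.Analysis"
begin

section \<open>Metric measure spaces\<close>

definition borel_on :: "'a topology \<Rightarrow> 'a measure \<Rightarrow> bool" where
  "borel_on T \<mu> \<longleftrightarrow>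
     space \<mu> = topspace T \<and> sets \<mu> = sigma_sets (topspace T) {U. openin T U}"

definition radon_measure :: "'a topology \<Rightarrow> 'a measure \<Rightarrow> bool" where
  "radon_measure T \<mu> \<longleftrightarrow>
     borel_on T \<mu> \<and>
     (\<forall>C. compactin T C \<longrightarrow> emeasure \<mu> C < \<infinity>) \<and>
     (\<forall>A\<in>sets \<mu>. emeasure \<mu> A = (INF U\<in>{U. openin T U \<and> A \<subseteq> U}. emeasure \<mu> U)) \<and>
     (\<forall>U. openin T U \<longrightarrow>
        emeasure \<mu> U = (SUP C\<in>{C. compactin T C \<and> C \<subseteq> U}. emeasure \<mu> C))"

definition full_support :: "'a topology \<Rightarrow> 'a measure \<Rightarrow> bool" where
  "full_support T \<mu> \<longleftrightarrow> (\<forall>U. openin T U \<and> U \<noteq> {} \<longrightarrow> 0 < emeasure \<mu> U)"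

definition ahlfors_regular ::
  "'a set \<Rightarrow> ('a \<Rightarrow> 'a \<Rightarrow> real) \<Rightarrow> 'a measure \<Rightarrow> real \<Rightarrow> bool" where
  "ahlfors_regular X d \<mu> dH \<longleftrightarrow>
     0 < dH \<and>
     (\<exists>c1>0. \<exists>c2>0. \<forall>x\<in>X. \<forall>r\<ge>0.
        ennreal (c1 * r powr dH) \<le> emeasure \<mu> (Metric_space.mball X d x r) \<and>
        emeasure \<mu> (Metric_space.mball X d x r) \<le> ennreal (c2 * r powr dH))"

definition geodesic_space :: "'a set \<Rightarrow> ('a \<Rightarrow> 'a \<Rightarrow> real) \<Rightarrow> bool" where
  "geodesic_space X d \<longleftrightarrow>
     (\<forall>x\<in>X. \<forall>y\<in>X. \<exists>\<gamma>::real \<Rightarrow> 'a.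
        \<gamma> ` {0..d x y} \<subseteq> X \<and> \<gamma> 0 = x \<and> \<gamma> (d x y) = y \<and>
        (\<forall>s\<in>{0..d x y}. \<forall>t\<in>{0..d x y}. d (\<gamma> s) (\<gamma> t) = \<bar>s - t\<bar>))"

definition fractional_metric_space ::
  "'a set \<Rightarrow> ('a \<Rightarrow> 'a \<Rightarrow> real) \<Rightarrow> 'a measure \<Rightarrow> real \<Rightarrow> bool" where
  "fractional_metric_space X d \<mu> dH \<longleftrightarrow>
     Metric_space X d \<and> Metric_space.mcomplete X d \<and>
     borel_on (Metric_space.mtopology X d) \<mu> \<and>
     ahlfors_regular X d \<mu> dH \<and> geodesic_space X d"


section \<open>Dirichlet forms on \<open>L\<^sup>2\<close>\<close>

text \<open>
  Elements of \<open>L\<^sup>2(X,\<mu>)\<close> are represented by measurable functions; the conditions below make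
  every object invariant under almost everywhere equality. Functions are total on the ambient
  type, but only their values on \<open>X = space \<mu>\<close> matter.
\<close>

definition L2 :: "'a measure \<Rightarrow> ('a \<Rightarrow> real) set" where
  "L2 \<mu> = {f \<in> borel_measurable \<mu>. integrable \<mu> (\<lambda>x. (f x)\<^sup>2)}"

definition L2_inner :: "'a measure \<Rightarrow> ('a \<Rightarrow> real) \<Rightarrow> ('a \<Rightarrow> real) \<Rightarrow> real" where
  "L2_inner \<mu> f g = (\<integral>x. f x * g x \<partial>\<mu>)"

definition L2_dist :: "'a measure \<Rightarrow> ('a \<Rightarrow> real) \<Rightarrow> ('a \<Rightarrow> real) \<Rightarrow> real" where
  "L2_dist \<mu> f g = sqrt (\<integral>x. (f x - g x)\<^sup>2 \<partial>\<mu>)"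

definition energy_dist ::
  "'a measure \<Rightarrow> (('a \<Rightarrow> real) \<Rightarrow> ('a \<Rightarrow> real) \<Rightarrow> real) \<Rightarrow> ('a \<Rightarrow> real) \<Rightarrow> ('a \<Rightarrow> real) \<Rightarrow> real" where
  "energy_dist \<mu> \<E> u v =
     sqrt (\<E> (\<lambda>x. u x - v x) (\<lambda>x. u x - v x) + (\<integral>x. (u x - v x)\<^sup>2 \<partial>\<mu>))"

locale dirichlet_form =
  fixes \<mu> :: "'a measure"
    and \<E> :: "('a \<Rightarrow> real) \<Rightarrow> ('a \<Rightarrow> real) \<Rightarrow> real"
    and \<F> :: "('a \<Rightarrow> real) set"
  assumes domain_L2: "\<F> \<subseteq> L2 \<mu>"
    and zero_mem: "(\<lambda>x. 0) \<in> \<F>"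
    and lin_mem: "u \<in> \<F> \<Longrightarrow> v \<in> \<F> \<Longrightarrow> (\<lambda>x. a * u x + b * v x) \<in> \<F>"
    and ae_mem: "u \<in> \<F> \<Longrightarrow> v \<in> borel_measurable \<mu> \<Longrightarrow> (AE x in \<mu>. u x = v x) \<Longrightarrow> v \<in> \<F>"
    and ae_cong: "u \<in> \<F> \<Longrightarrow> v \<in> \<F> \<Longrightarrow> w \<in> \<F> \<Longrightarrow> (AE x in \<mu>. u x = v x) \<Longrightarrow> \<E> u w = \<E> v w"
    and bilinear: "u \<in> \<F> \<Longrightarrow> v \<in> \<F> \<Longrightarrow> w \<in> \<F> \<Longrightarrow>
                     \<E> (\<lambda>x. a * u x + b * v x) w = a * \<E> u w + b * \<E> v w"
    and symmetric: "u \<in> \<F> \<Longrightarrow> v \<in> \<F> \<Longrightarrow> \<E> u v = \<E> v u"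
    and nonnegative: "u \<in> \<F> \<Longrightarrow> 0 \<le> \<E> u u"
    and densely_defined: "f \<in> L2 \<mu> \<Longrightarrow> 0 < \<epsilon> \<Longrightarrow> \<exists>u\<in>\<F>. L2_dist \<mu> f u < \<epsilon>"
    and closed: "(\<forall>n. U n \<in> \<F>) \<Longrightarrow>
                 (\<forall>\<epsilon>>0. \<exists>N::nat. \<forall>m\<ge>N. \<forall>n\<ge>N. energy_dist \<mu> \<E> (U m) (U n) < \<epsilon>) \<Longrightarrow>
                 \<exists>u\<in>\<F>. (\<lambda>n. energy_dist \<mu> \<E> (U n) u) \<longlonglongrightarrow> 0"
    and markov: "u \<in> \<F> \<Longrightarrow>
                 (\<lambda>x. min 1 (max 0 (u x))) \<in> \<F> \<and>
                 \<E> (\<lambda>x. min 1 (max 0 (u x))) (\<lambda>x. min 1 (max 0 (u x))) \<le> \<E> u u"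

definition compactly_supported_continuous :: "'a topology \<Rightarrow> ('a \<Rightarrow> real) set" where
  "compactly_supported_continuous T =
     {f. continuous_map T euclideanreal f \<and>
         (\<exists>C. compactin T C \<and> (\<forall>x\<in>topspace T - C. f x = 0))}"

definition regular_form ::
  "'a topology \<Rightarrow> 'a measure \<Rightarrow> (('a \<Rightarrow> real) \<Rightarrow> ('a \<Rightarrow> real) \<Rightarrow> real) \<Rightarrow> ('a \<Rightarrow> real) set \<Rightarrow> bool" where
  "regular_form T \<mu> \<E> \<F> \<longleftrightarrow>
     (\<forall>u\<in>\<F>. \<forall>\<epsilon>>0. \<exists>v\<in>\<F> \<inter> compactly_supported_continuous T. energy_dist \<mu> \<E> u v < \<epsilon>) \<and>
     (\<forall>f\<in>compactly_supported_continuous T. \<forall>\<epsilon>>0.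
        \<exists>v\<in>\<F> \<inter> compactly_supported_continuous T. \<forall>x\<in>topspace T. \<bar>f x - v x\<bar> < \<epsilon>)"

text \<open>The support of the class of \<open>u\<close>, i.e. of the measure \<open>\<bar>u\<bar> \<mu>\<close>.\<close>

definition ess_support :: "'a topology \<Rightarrow> 'a measure \<Rightarrow> ('a \<Rightarrow> real) \<Rightarrow> 'a set" where
  "ess_support T \<mu> u =
     {x \<in> topspace T. \<forall>U. openin T U \<and> x \<in> U \<longrightarrow> \<not> (AE y in \<mu>. y \<in> U \<longrightarrow> u y = 0)}"

definition strongly_local ::
  "'a topology \<Rightarrow> 'a measure \<Rightarrow> (('a \<Rightarrow> real) \<Rightarrow> ('a \<Rightarrow> real) \<Rightarrow> real) \<Rightarrow> ('a \<Rightarrow> real) set \<Rightarrow> bool" where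
  "strongly_local T \<mu> \<E> \<F> \<longleftrightarrow>
     (\<forall>u\<in>\<F>. \<forall>v\<in>\<F>.
        compactin T (ess_support T \<mu> u) \<and> compactin T (ess_support T \<mu> v) \<and>
        (\<exists>U c. openin T U \<and> ess_support T \<mu> v \<subseteq> U \<and> (AE x in \<mu>. x \<in> U \<longrightarrow> u x = c))
        \<longrightarrow> \<E> u v = 0)"

text \<open>
  The heat semigroup of \<open>(\<E>,\<F>)\<close> is the strongly continuous contraction semigroup on
  \<open>L\<^sup>2(X,\<mu>)\<close> whose infinitesimal generator \<open>\<Delta>\<close> is the generator of the form:
  \<open>u \<in> dom \<Delta>\<close> and \<open>\<Delta> u = h\<close> iff \<open>u \<in> \<F>\<close> and \<open>\<E> u v = - \<langle>h, v\<rangle>\<close> for all \<open>v \<in> \<F>\<close>.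
\<close>

locale heat_semigroup =
  fixes \<mu> :: "'a measure"
    and \<E> :: "('a \<Rightarrow> real) \<Rightarrow> ('a \<Rightarrow> real) \<Rightarrow> real"
    and \<F> :: "('a \<Rightarrow> real) set"
    and P :: "real \<Rightarrow> ('a \<Rightarrow> real) \<Rightarrow> ('a \<Rightarrow> real)"
  assumes P_L2: "0 < t \<Longrightarrow> f \<in> L2 \<mu> \<Longrightarrow> P t f \<in> L2 \<mu>"
    and P_linear: "0 < t \<Longrightarrow> f \<in> L2 \<mu> \<Longrightarrow> g \<in> L2 \<mu> \<Longrightarrow>
                     AE x in \<mu>. P t (\<lambda>y. a * f y + b * g y) x = a * P t f x + b * P t g x"
    and P_contraction: "0 < t \<Longrightarrow> f \<in> L2 \<mu> \<Longrightarrow> L2_inner \<mu> (P t f) (P t f) \<le> L2_inner \<mu> f f"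
    and P_semigroup: "0 < s \<Longrightarrow> 0 < t \<Longrightarrow> f \<in> L2 \<mu> \<Longrightarrow>
                        AE x in \<mu>. P (s + t) f x = P s (P t f) x"
    and P_continuous: "f \<in> L2 \<mu> \<Longrightarrow> ((\<lambda>t. L2_dist \<mu> (P t f) f) \<longlongrightarrow> 0) (at_right 0)"
    and P_generator: "u \<in> L2 \<mu> \<Longrightarrow> h \<in> L2 \<mu> \<Longrightarrow>
                        ((\<lambda>t. L2_dist \<mu> (\<lambda>x. (P t u x - u x) / t) h) \<longlongrightarrow> 0) (at_right 0) \<longleftrightarrow>
                        (u \<in> \<F> \<and> (\<forall>v\<in>\<F>. \<E> u v = - L2_inner \<mu> h v))"

definition continuous_heat_kernel ::
  "'a topology \<Rightarrow> 'a measure \<Rightarrow> (real \<Rightarrow> ('a \<Rightarrow> real) \<Rightarrow> ('a \<Rightarrow> real)) \<Rightarrow>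
   (real \<Rightarrow> 'a \<Rightarrow> 'a \<Rightarrow> real) \<Rightarrow> bool" where
  "continuous_heat_kernel T \<mu> P p \<longleftrightarrow>
     (\<forall>t>0. continuous_map (prod_topology T T) euclideanreal (\<lambda>(x, y). p t x y) \<and>
        (\<forall>f\<in>L2 \<mu>. AE x in \<mu>. integrable \<mu> (\<lambda>y. p t x y * f y) \<and>
                               P t f x = (\<integral>y. p t x y * f y \<partial>\<mu>)))"

definition sub_Gaussian_bounds ::
  "'a measure \<Rightarrow> ('a \<Rightarrow> 'a \<Rightarrow> real) \<Rightarrow> (real \<Rightarrow> 'a \<Rightarrow> 'a \<Rightarrow> real) \<Rightarrow> real \<Rightarrow> real \<Rightarrow> bool" where
  "sub_Gaussian_bounds \<mu> d p dH dW \<longleftrightarrow>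
     2 < dW \<and>
     (\<exists>c3>0. \<exists>c4>0. \<exists>c5>0. \<exists>c6>0. \<forall>t>0. AE (x, y) in \<mu> \<Otimes>\<^sub>M \<mu>.
        c5 * t powr (- dH / dW) * exp (- c6 * ((d x y powr dW) / t) powr (1 / (dW - 1))) \<le> p t x y \<and>
        p t x y \<le> c3 * t powr (- dH / dW) * exp (- c4 * ((d x y powr dW) / t) powr (1 / (dW - 1))))"

locale sub_Gaussian_dirichlet_space =
  Metric_space X d + dirichlet_form \<mu> \<E> \<F> + heat_semigroup \<mu> \<E> \<F> P
  for X :: "'a set" and d :: "'a \<Rightarrow> 'a \<Rightarrow> real" and \<mu> :: "'a measure"
    and \<E> :: "('a \<Rightarrow> real) \<Rightarrow> ('a \<Rightarrow> real) \<Rightarrow> real" and \<F> :: "('a \<Rightarrow> real) set"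
    and P :: "real \<Rightarrow> ('a \<Rightarrow> real) \<Rightarrow> ('a \<Rightarrow> real)" +
  fixes p :: "real \<Rightarrow> 'a \<Rightarrow> 'a \<Rightarrow> real" and dH dW :: real
  assumes locally_compact: "locally_compact_space mtopology"
    and radon: "radon_measure mtopology \<mu>"
    and support: "full_support mtopology \<mu>"
    and balls_relatively_compact:
      "x \<in> X \<Longrightarrow> 0 < r \<Longrightarrow> compactin mtopology (mtopology closure_of mball x r)"
    and ahlfors: "ahlfors_regular X d \<mu> dH"
    and regular: "regular_form mtopology \<mu> \<E> \<F>"
    and local: "strongly_local mtopology \<mu> \<E> \<F>"
    and heat_kernel: "continuous_heat_kernel mtopology \<mu> P p"
    and heat_kernel_bounds: "sub_Gaussian_bounds \<mu> d p dH dW"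


section \<open>Heat semigroup based Besov classes\<close>

definition besov_seminorm1 ::
  "'a measure \<Rightarrow> (real \<Rightarrow> 'a \<Rightarrow> 'a \<Rightarrow> real) \<Rightarrow> real \<Rightarrow> ('a \<Rightarrow> real) \<Rightarrow> ennreal" where
  "besov_seminorm1 \<mu> p \<alpha> f =
     (SUP t\<in>{0<..}. ennreal (t powr (- \<alpha>)) *
        (\<integral>\<^sup>+x. (\<integral>\<^sup>+y. ennreal (\<bar>f x - f y\<bar> * p t x y) \<partial>\<mu>) \<partial>\<mu>))"

definition besov1 ::
  "'a measure \<Rightarrow> (real \<Rightarrow> 'a \<Rightarrow> 'a \<Rightarrow> real) \<Rightarrow> real \<Rightarrow> ('a \<Rightarrow> real) set" where
  "besov1 \<mu> p \<alpha> = {f. integrable \<mu> f \<and> besov_seminorm1 \<mu> p \<alpha> f < \<infinity>}"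

definition dense_in_L1 :: "'a measure \<Rightarrow> ('a \<Rightarrow> real) set \<Rightarrow> bool" where
  "dense_in_L1 \<mu> \<A> \<longleftrightarrow>
     (\<forall>f. integrable \<mu> f \<longrightarrow>
        (\<forall>\<epsilon>>0. \<exists>g\<in>\<A>. integrable \<mu> g \<and> (\<integral>x. \<bar>f x - g x\<bar> \<partial>\<mu>) < \<epsilon>))"

text \<open>Taken in the extended reals, so that no value is forced on an unbounded or empty set.\<close>

definition critical_exponent1 :: "'a measure \<Rightarrow> (real \<Rightarrow> 'a \<Rightarrow> 'a \<Rightarrow> real) \<Rightarrow> ereal" where
  "critical_exponent1 \<mu> p = Sup (ereal ` {\<alpha>. 0 < \<alpha> \<and> dense_in_L1 \<mu> (besov1 \<mu> p \<alpha>)})"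


section \<open>Nested fractals\<close>

text \<open>The maps \<open>\<psi> 1, \<dots>, \<psi> M\<close> are indexed by \<open>{1..M}\<close>.\<close>

definition words :: "nat \<Rightarrow> nat \<Rightarrow> nat list set" where
  "words M m = {w. length w = m \<and> set w \<subseteq> {1..M}}"

definition word_map :: "(nat \<Rightarrow> 'a \<Rightarrow> 'a) \<Rightarrow> nat list \<Rightarrow> 'a \<Rightarrow> 'a" where
  "word_map \<psi> w = foldr (\<lambda>i f. \<psi> i \<circ> f) w id"

definition fixed_points :: "nat \<Rightarrow> (nat \<Rightarrow> 'a \<Rightarrow> 'a) \<Rightarrow> 'a set" where
  "fixed_points M \<psi> = {x. \<exists>k\<in>{1..M}. \<psi> k x = x}"

definition essential_fixed_points :: "nat \<Rightarrow> (nat \<Rightarrow> 'a \<Rightarrow> 'a) \<Rightarrow> 'a set" where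
  "essential_fixed_points M \<psi> =
     {x \<in> fixed_points M \<psi>. \<exists>y\<in>fixed_points M \<psi>. y \<noteq> x \<and>
        (\<exists>i\<in>{1..M}. \<exists>j\<in>{1..M}. i \<noteq> j \<and> \<psi> i x = \<psi> j y)}"

text \<open>Reflection in the hyperplane bisecting the segment from \<open>x\<close> to \<open>y\<close>.\<close>

definition bisector_reflection :: "'a::euclidean_space \<Rightarrow> 'a \<Rightarrow> 'a \<Rightarrow> 'a" where
  "bisector_reflection x y z =
     z - (2 * ((z - midpoint x y) \<bullet> (x - y)) / ((x - y) \<bullet> (x - y))) *\<^sub>R (x - y)"

locale nested_fractal =
  fixes M :: nat and L :: real and \<psi> :: "nat \<Rightarrow> 'a::euclidean_space \<Rightarrow> 'a" and K :: "'a set"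
  assumes M_ge_2: "2 \<le> M"
    and L_gt_1: "1 < L"
    and similitude: "i \<in> {1..M} \<Longrightarrow> dist (\<psi> i x) (\<psi> i y) = dist x y / L"
    and open_set_condition:
      "\<exists>G. open G \<and> bounded G \<and> G \<noteq> {} \<and> (\<forall>i\<in>{1..M}. \<psi> i ` G \<subseteq> G) \<and>
           (\<forall>i\<in>{1..M}. \<forall>j\<in>{1..M}. i \<noteq> j \<longrightarrow> \<psi> i ` G \<inter> \<psi> j ` G = {})"
    and K_compact: "compact K"
    and K_nonempty: "K \<noteq> {}"
    and K_self_similar: "K = (\<Union>i\<in>{1..M}. \<psi> i ` K)"
    and two_essential: "2 \<le> card (essential_fixed_points M \<psi>)"
    and connectivity:
      "x \<in> (\<Union>i\<in>{1..M}. \<psi> i ` essential_fixed_points M \<psi>) \<Longrightarrow>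
       y \<in> (\<Union>i\<in>{1..M}. \<psi> i ` essential_fixed_points M \<psi>) \<Longrightarrow>
       (x, y) \<in> {(a, b). \<exists>i\<in>{1..M}. a \<in> \<psi> i ` essential_fixed_points M \<psi> \<and>
                                   b \<in> \<psi> i ` essential_fixed_points M \<psi>}\<^sup>*"
    and symmetry:
      "x \<in> essential_fixed_points M \<psi> \<Longrightarrow> y \<in> essential_fixed_points M \<psi> \<Longrightarrow> x \<noteq> y \<Longrightarrow>
       w \<in> words M m \<Longrightarrow>
       \<exists>w'\<in>words M m. bisector_reflection x y ` word_map \<psi> w ` essential_fixed_points M \<psi> =
                       word_map \<psi> w' ` essential_fixed_points M \<psi>"
    and nesting:
      "w \<in> words M m \<Longrightarrow> w' \<in> words M m \<Longrightarrow> w \<noteq> w' \<Longrightarrow>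
       word_map \<psi> w ` K \<inter> word_map \<psi> w' ` K =
       word_map \<psi> w ` essential_fixed_points M \<psi> \<inter> word_map \<psi> w' ` essential_fixed_points M \<psi>"

locale normalized_nested_fractal = nested_fractal M L \<psi> K
  for M :: nat and L :: real and \<psi> :: "nat \<Rightarrow> 'a::euclidean_space \<Rightarrow> 'a" and K :: "'a set" +
  assumes psi_1: "\<psi> 1 x = x /\<^sub>R L"
    and zero_essential: "0 \<in> essential_fixed_points M \<psi>"

definition unbounded_fractal :: "real \<Rightarrow> 'a::euclidean_space set \<Rightarrow> 'a set" where
  "unbounded_fractal L K = (\<Union>m::nat. (\<lambda>x. L ^ m *\<^sub>R x) ` K)"

definition cell ::
  "real \<Rightarrow> (nat \<Rightarrow> 'a::euclidean_space \<Rightarrow> 'a) \<Rightarrow> 'a set \<Rightarrow> nat \<Rightarrow> nat list \<Rightarrow> 'a set" where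
  "cell L \<psi> K m w = (\<lambda>x. L ^ m *\<^sub>R x) ` word_map \<psi> w ` K"

text \<open>
  By the nesting axiom, the topological boundary in the unbounded fractal of every such cell is
  a finite subset of the scaled image of the essential fixed points, so a finiteness condition
  on the boundary would not single out a smaller family.
\<close>

definition cells ::
  "nat \<Rightarrow> real \<Rightarrow> (nat \<Rightarrow> 'a::euclidean_space \<Rightarrow> 'a) \<Rightarrow> 'a set \<Rightarrow> 'a set set" where
  "cells M L \<psi> K = {cell L \<psi> K m w | m w. set w \<subseteq> {1..M}}"

text \<open>\<open>cell L \<psi> K m w\<close> is a copy of \<open>K\<close> scaled by \<open>L\<close> to the power \<open>m - length w\<close>.\<close>

definition self_similar_measure ::
  "nat \<Rightarrow> real \<Rightarrow> (nat \<Rightarrow> 'a::euclidean_space \<Rightarrow> 'a) \<Rightarrow> 'a set \<Rightarrow> 'a measure \<Rightarrow> bool" where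
  "self_similar_measure M L \<psi> K \<mu> \<longleftrightarrow>
     (\<forall>m n v w. set v \<subseteq> {1..M} \<and> set w \<subseteq> {1..M} \<and>
        int m - int (length v) = int n - int (length w) \<longrightarrow>
        emeasure \<mu> (cell L \<psi> K m v) = emeasure \<mu> (cell L \<psi> K n w))"

text \<open>
  An unbounded nested fractal regarded as a sub-Gaussian Dirichlet space. The geodesic metric
  \<open>d\<close> and the Dirichlet form are arbitrary subject to the listed properties, which hold in
  particular for the form of Lindstrom's Brownian motion; the self-similar measure \<open>\<mu>\<close> is
  determined up to a constant factor.
\<close>

locale unbounded_nested_fractal_dirichlet_space =
  normalized_nested_fractal M L \<psi> K +
  sub_Gaussian_dirichlet_space "unbounded_fractal L K" d \<mu> \<E> \<F> P p dH dW
  for M :: nat and L :: real and \<psi> :: "nat \<Rightarrow> 'a::euclidean_space \<Rightarrow> 'a" and K :: "'a set"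
    and d :: "'a \<Rightarrow> 'a \<Rightarrow> real" and \<mu> :: "'a measure"
    and \<E> :: "('a \<Rightarrow> real) \<Rightarrow> ('a \<Rightarrow> real) \<Rightarrow> real" and \<F> :: "('a \<Rightarrow> real) set"
    and P :: "real \<Rightarrow> ('a \<Rightarrow> real) \<Rightarrow> ('a \<Rightarrow> real)"
    and p :: "real \<Rightarrow> 'a \<Rightarrow> 'a \<Rightarrow> real" and dH dW :: real +
  assumes euclidean_topology: "mtopology = top_of_set (unbounded_fractal L K)"
    and fractional: "fractional_metric_space (unbounded_fractal L K) d \<mu> dH"
    and self_similar: "self_similar_measure M L \<psi> K \<mu>"
    and dH_ge_1: "1 \<le> dH"
    and dH_less_dW: "dH < dW"

end

(* Let C be a cell with finite boundary B. A geodesic from C to its complement meets B, so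
   d x y = d x b + d b y for some b in B, and the heat kernel at (x, y) is at most a sum over b of
   products of a function of x and a function of y, each of integral O(t^(dH/dW)). The prefactor
   t^(-dH/dW) leaves O(t^(dH/dW)), so indicators of cells are in the Besov class; small cells
   approximate open sets from inside, which gives density.

   Conversely, let f be in the Besov class of exponent alpha > dH/dW. The lower heat kernel bound
   makes the L^1-oscillation of f at scale r of order r^(dH + alpha dW). Comparing averages of f
   over disjoint balls of radius r/2 strung along a geodesic, any two averages differ by at most
   O(r^(-2 dH)) times this oscillation, i.e. O(r^(alpha dW - dH)) -> 0. Hence f is constant almost
   everywhere, and zero because the space has infinite measure. *)
theory Submission
  imports Defs "HOL-Real_Asymp.Real_Asymp"
begin

section \<open>Cells of nested fractals\<close>

text \<open>Disjointness of the balls along the geodesic decides the exponent. A chain at scale r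
  has about 1/r links; bounding each link by the whole oscillation would lose a factor 1/r and reach
  only exponents above (dH + 1)/dW. Each link is instead bounded by the part of the oscillation
  integral carried by its own ball, and disjoint balls carry the whole integral at most once. The
  factor r^(-2 dH) comes from the two ball volumes that normalize the averages. That finitely many
  points b suffice for a cell is where the fractal enters: nesting confines the contact of
  equal-size cells to vertices, and the open set condition leaves only finitely many such cells near
  any point, so a cell minus its vertices is open. The kernel then decouples because both distances
  to b are at most d x y: half of the exponent can be given to each variable. Density is obtained
  within the functions having a finite cut set, a class closed under sums and multiples before any
  seminorm is computed.\<close>

lemma word_map_Nil [simp]: "word_map \<psi> [] = id"
  by (simp add: word_map_def)

lemma word_map_Cons [simp]: "word_map \<psi> (i # w) = \<psi> i \<circ> word_map \<psi> w"
  by (simp add: word_map_def)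

text \<open>Divided by \<open>c\<close> and translated to fix the origin, the map becomes an
  isometry, hence an orthogonal transformation, and these are onto in finite dimension. Surjectivity
  serves to pull a point of one copy back through the map of another.\<close>

lemma similitude_surj:
  fixes f :: "'a::euclidean_space \<Rightarrow> 'a"
  assumes "0 < c" and f: "\<And>x y. dist (f x) (f y) = c * dist x y"
  shows "surj f"
proof -
  define g where "g x = (1 / c) *\<^sub>R (f x - f 0)" for x
  have gd: "dist (g x) (g y) = dist x y" for x y
  proof -
    have "g x - g y = (1 / c) *\<^sub>R (f x - f y)"
      by (simp add: g_def algebra_simps)
    then show ?thesis
      using f[of x y] \<open>0 < c\<close> by (simp add: dist_norm)
  qed
  have "orthogonal_transformation g"
    unfolding orthogonal_transformation_isometry by (simp add: gd) (simp add: g_def)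
  then have "surj g"
    by (rule orthogonal_transformation_surj)
  show ?thesis
  proof (rule surjI)
    fix y
    have "f (inv g ((1 / c) *\<^sub>R (y - f 0))) = f 0 + c *\<^sub>R g (inv g ((1 / c) *\<^sub>R (y - f 0)))"
      using \<open>0 < c\<close> by (simp add: g_def)
    also have "\<dots> = y"
      using \<open>surj g\<close> \<open>0 < c\<close> by (simp add: surj_f_inv_f)
    finally show "f (inv g ((1 / c) *\<^sub>R (y - f 0))) = y" .
  qed
qed

text \<open>A ball of radius \<rho> inside \<open>G\<close> becomes a ball of radius c * \<rho>
  inside each image of \<open>G\<close>, and these images are disjoint, so the centres
  \<open>f a\<close> are at least c * \<rho> apart. Copies of \<open>K\<close> meeting
  \<open>S\<close> have centres in a bounded set, and a bounded separated set is finite.\<close>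

lemma locally_finite_similar_copies:
  fixes T :: "('a::euclidean_space \<Rightarrow> 'a) set"
  assumes "0 < c" and T: "\<And>f x y. f \<in> T \<Longrightarrow> dist (f x) (f y) = c * dist x y"
    and "open G" "G \<noteq> {}"
    and disj: "\<And>f g. f \<in> T \<Longrightarrow> g \<in> T \<Longrightarrow> f \<noteq> g \<Longrightarrow> f ` G \<inter> g ` G = {}"
    and "bounded K" "bounded S"
  shows "finite {f \<in> T. f ` K \<inter> S \<noteq> {}}"
proof -
  let ?F = "{f \<in> T. f ` K \<inter> S \<noteq> {}}"
  obtain a where "a \<in> G" using \<open>G \<noteq> {}\<close> by auto
  obtain \<rho> where "0 < \<rho>" and \<rho>: "ball a \<rho> \<subseteq> G"
    using \<open>open G\<close> \<open>a \<in> G\<close> openE by blast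
  have sep: "c * \<rho> \<le> dist (f a) (g a)" if "f \<in> T" "g \<in> T" "f \<noteq> g" for f g
  proof (rule ccontr)
    assume "\<not> c * \<rho> \<le> dist (f a) (g a)"
    then have lt: "dist (f a) (g a) < c * \<rho>" by simp
    obtain b where b: "g a = f b"
      using similitude_surj[OF \<open>0 < c\<close> T[OF \<open>f \<in> T\<close>]] by (metis surjD)
    have "dist a b < \<rho>"
      using lt T[OF \<open>f \<in> T\<close>, of a b] \<open>0 < c\<close> b by simp
    then have "b \<in> G" using \<rho> by auto
    then have "g a \<in> f ` G \<inter> g ` G" using b \<open>a \<in> G\<close> by (metis IntI imageI)
    then show False using disj[OF that] by simp
  qed
  have inj: "inj_on (\<lambda>f. f a) ?F"
  proof (rule inj_onI)
    fix f g assume fg: "f \<in> ?F" "g \<in> ?F" "f a = g a"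
    show "f = g"
    proof (rule ccontr)
      assume "f \<noteq> g"
      then have "c * \<rho> \<le> dist (f a) (g a)" using fg sep by blast
      then show False using fg mult_pos_pos[OF \<open>0 < c\<close> \<open>0 < \<rho>\<close>] by simp
    qed
  qed
  obtain R where R: "\<And>x. x \<in> K \<Longrightarrow> dist a x \<le> R"
    using \<open>bounded K\<close> bounded_any_center[where a = a] by blast
  obtain R' where R': "\<And>x. x \<in> S \<Longrightarrow> dist a x \<le> R'"
    using \<open>bounded S\<close> bounded_any_center[where a = a] by blast
  have "(\<lambda>f. f a) ` ?F \<subseteq> cball a (R' + c * R)"
  proof (rule image_subsetI)
    fix f assume "f \<in> ?F"
    then obtain x where f: "f \<in> T" "x \<in> K" "f x \<in> S" by blast
    have "dist a (f a) \<le> dist a (f x) + dist (f x) (f a)" by (rule dist_triangle)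
    also have "dist (f x) (f a) \<le> c * R"
      using T[OF f(1), of x a] R[OF f(2)] \<open>0 < c\<close> by (simp add: dist_commute)
    finally show "f a \<in> cball a (R' + c * R)" using R'[OF f(3)] by simp
  qed
  then have bdd: "bounded ((\<lambda>f. f a) ` ?F)"
    by (rule bounded_subset[OF bounded_cball])
  have "finite ((\<lambda>f. f a) ` ?F)"
  proof (rule ccontr)
    assume inf: "infinite ((\<lambda>f. f a) ` ?F)"
    obtain l where l: "l islimpt ((\<lambda>f. f a) ` ?F)"
      using bounded_infinite_imp_islimpt[OF order_refl bdd inf] by blast
    \<comment> \<open>Half the separation: two distinct centres in a ball of this radius would be
      too close.\<close>
    have cr: "0 < c * \<rho> / 2" using \<open>0 < c\<close> \<open>0 < \<rho>\<close> by simp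
    then have "infinite ((\<lambda>f. f a) ` ?F \<inter> ball l (c * \<rho> / 2))"
      using l islimpt_eq_infinite_ball by blast
    then obtain x y where xy: "x \<in> (\<lambda>f. f a) ` ?F \<inter> ball l (c * \<rho> / 2)"
       "y \<in> (\<lambda>f. f a) ` ?F \<inter> ball l (c * \<rho> / 2)" "x \<noteq> y"
      by (metis (no_types, lifting) finite.simps infinite_imp_nonempty insertI1 equals0I finite_subset subsetI singleton_iff)
    then obtain f g where fg: "f \<in> T" "g \<in> T" "x = f a" "y = g a" by blast
    then have "f \<noteq> g" using xy by auto
    then have "c * \<rho> \<le> dist x y" using sep fg by blast
    moreover have "dist x y < c * \<rho>"
      using xy dist_triangle_half_r[of l x "c * \<rho>" y] by (simp add: dist_commute)
    ultimately show False by simp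
  qed
  then show ?thesis using inj finite_image_iff by blast
qed

section \<open>Words and the pieces of the compact fractal\<close>

context nested_fractal
begin

lemma word_map_similitude:
  assumes "set w \<subseteq> {1..M}"
  shows "dist (word_map \<psi> w x) (word_map \<psi> w y) = dist x y / L ^ length w"
  using assms by (induction w) (auto simp: similitude)

lemma K_eq_UN_words: "K = (\<Union>w\<in>words M m. word_map \<psi> w ` K)"
proof (induction m)
  case 0
  have "words M 0 = {[]}" by (auto simp: words_def)
  then show ?case by simp
next
  case (Suc m)
  have "K = (\<Union>i\<in>{1..M}. \<psi> i ` K)" by (rule K_self_similar)
  also have "\<dots> = (\<Union>i\<in>{1..M}. \<psi> i ` (\<Union>w\<in>words M m. word_map \<psi> w ` K))"
    using Suc.IH by simp
  also have "\<dots> = (\<Union>w\<in>words M (Suc m). word_map \<psi> w ` K)"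
  proof (intro set_eqI iffI)
    fix x assume "x \<in> (\<Union>i\<in>{1..M}. \<psi> i ` (\<Union>w\<in>words M m. word_map \<psi> w ` K))"
    then obtain i w y where "i \<in> {1..M}" "w \<in> words M m" "y \<in> K" "x = \<psi> i (word_map \<psi> w y)"
      by blast
    then have "i # w \<in> words M (Suc m)" "x = word_map \<psi> (i # w) y" by (auto simp: words_def)
    then show "x \<in> (\<Union>w\<in>words M (Suc m). word_map \<psi> w ` K)" using \<open>y \<in> K\<close> by blast
  next
    fix x assume "x \<in> (\<Union>w\<in>words M (Suc m). word_map \<psi> w ` K)"
    then obtain u y where u: "u \<in> words M (Suc m)" "y \<in> K" "x = word_map \<psi> u y" by blast
    then obtain i w where "u = i # w" "i \<in> {1..M}" "w \<in> words M m"
      by (auto simp: words_def length_Suc_conv)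
    then show "x \<in> (\<Union>i\<in>{1..M}. \<psi> i ` (\<Union>w\<in>words M m. word_map \<psi> w ` K))"
      using u by fastforce
  qed
  finally show ?case .
qed

lemma word_map_image_subset:
  assumes "set w \<subseteq> {1..M}" "\<And>i. i \<in> {1..M} \<Longrightarrow> \<psi> i ` G \<subseteq> G"
  shows "word_map \<psi> w ` G \<subseteq> G"
  using assms by (induction w) (auto simp: image_subset_iff)

text \<open>If the first letters differ, the disjointness of the first-level images decides; if they
  agree, the common map is injective and the claim passes to the tails.\<close>

lemma word_map_disjoint:
  assumes sub: "\<And>i. i \<in> {1..M} \<Longrightarrow> \<psi> i ` G \<subseteq> G"
    and disj: "\<And>i j. i \<in> {1..M} \<Longrightarrow> j \<in> {1..M} \<Longrightarrow> i \<noteq> j \<Longrightarrow> \<psi> i ` G \<inter> \<psi> j ` G = {}"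
  assumes "w \<in> words M m" "w' \<in> words M m" "w \<noteq> w'"
  shows "word_map \<psi> w ` G \<inter> word_map \<psi> w' ` G = {}"
  using assms(3-)
proof (induction m arbitrary: w w')
  case 0
  then show ?case by (auto simp: words_def)
next
  case (Suc m)
  obtain i u where w: "w = i # u" "i \<in> {1..M}" "u \<in> words M m"
    using Suc.prems(1) by (auto simp: words_def length_Suc_conv)
  obtain j v where w': "w' = j # v" "j \<in> {1..M}" "v \<in> words M m"
    using Suc.prems(2) by (auto simp: words_def length_Suc_conv)
  have u: "word_map \<psi> u ` G \<subseteq> G" and v: "word_map \<psi> v ` G \<subseteq> G"
    using w w' word_map_image_subset[OF _ sub] by (auto simp: words_def simp del: One_nat_def)
  show ?case
  proof (cases "i = j")
    case False
    then have "\<psi> i ` G \<inter> \<psi> j ` G = {}" using disj w w' by blast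
    moreover have "word_map \<psi> w ` G \<subseteq> \<psi> i ` G" "word_map \<psi> w' ` G \<subseteq> \<psi> j ` G"
      using u v w w' by auto
    ultimately show ?thesis by blast
  next
    case True
    have "inj (\<psi> i)"
    proof (rule injI)
      fix x y assume "\<psi> i x = \<psi> i y"
      then show "x = y" using similitude[OF w(2), of x y] L_gt_1 by simp
    qed
    have "word_map \<psi> u ` G \<inter> word_map \<psi> v ` G = {}"
      using Suc.IH[OF w(3) w'(3)] Suc.prems(3) w w' True by simp
    then have "\<psi> i ` (word_map \<psi> u ` G) \<inter> \<psi> i ` (word_map \<psi> v ` G) = {}"
      using image_Int[OF \<open>inj (\<psi> i)\<close>] by (metis image_empty)
    then show ?thesis using w w' True by (simp add: image_comp)
  qed
qed

text \<open>Every \<open>\<psi> k\<close> shrinks distances by a factor \<open>L\<close> > 1 and so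
  contributes at most one fixed point. The finite cut sets of cells come from here.\<close>

lemma finite_essential_fixed_points: "finite (essential_fixed_points M \<psi>)"
proof -
  have "finite {x. \<psi> k x = x}" if "k \<in> {1..M}" for k
  proof -
    have "x = y" if "\<psi> k x = x" "\<psi> k y = y" for x y
    proof (rule ccontr)
      assume "x \<noteq> y"
      then have "0 < dist x y" by simp
      have "dist x y * L = dist x y"
        using similitude[OF \<open>k \<in> {1..M}\<close>, of x y] that L_gt_1 by (simp add: field_simps)
      then show False using \<open>0 < dist x y\<close> L_gt_1 by simp
    qed
    then have "{x. \<psi> k x = x} \<subseteq> {SOME x. \<psi> k x = x}"
      by (metis (mono_tags, lifting) mem_Collect_eq singletonI someI subsetI)
    then show ?thesis by (rule finite_subset) simp
  qed
  then have "finite (fixed_points M \<psi>)"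
    unfolding fixed_points_def Collect_bex_eq by blast
  then show ?thesis
    by (rule finite_subset[rotated]) (auto simp: essential_fixed_points_def)
qed

lemma compact_cell:
  assumes "set w \<subseteq> {1..M}"
  shows "compact (cell L \<psi> K m w)"
proof -
  have "continuous_on UNIV (word_map \<psi> w)"
    unfolding continuous_on_iff
  proof (intro ballI allI impI)
    fix x :: 'a and e :: real assume "0 < e"
    then show "\<exists>d>0. \<forall>x'\<in>UNIV. dist x' x < d \<longrightarrow> dist (word_map \<psi> w x') (word_map \<psi> w x) < e"
      using L_gt_1
      by (intro exI[of _ "e * L ^ length w"]) (auto simp: word_map_similitude[OF assms] field_simps)
  qed
  then have "compact (word_map \<psi> w ` K)"
    using K_compact compact_continuous_image continuous_on_subset by blast
  then show ?thesis
    unfolding cell_def by (rule compact_scaling)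
qed

end

section \<open>Copies of equal size in the unbounded fractal\<close>

context normalized_nested_fractal
begin

text \<open>Since \<open>\<psi> 1\<close> is division by \<open>L\<close>, leading letters 1 cancel
  against powers of \<open>L\<close>. Copies from different blow-ups of \<open>K\<close> can thus be
  written at one common level, where the axioms on words of equal length apply.\<close>

lemma word_map_replicate_1: "word_map \<psi> (replicate n 1 @ v) x = (1 / L ^ n) *\<^sub>R word_map \<psi> v x"
proof (induction n)
  case (Suc n)
  show ?case using Suc psi_1[of "word_map \<psi> (replicate n 1 @ v) x"] by (simp add: field_simps)
qed simp

lemma replicate_1_words: "v \<in> words M l \<Longrightarrow> replicate n 1 @ v \<in> words M (n + l)"
  using M_ge_2 by (auto simp: words_def)

text \<open>The similitudes of ratio \<open>L ^ m / L ^ l\<close> that carry \<open>K\<close> onto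
  cells, over all blow-up levels m + k. Maps are collected rather than pairs of \<open>k\<close> and
  \<open>v\<close>, because padding \<open>v\<close> with leading letters 1 yields another pair for
  the same copy.\<close>

definition similar_copies :: "nat \<Rightarrow> nat \<Rightarrow> ('a \<Rightarrow> 'a) set" where
  "similar_copies m l = {(\<lambda>x. L ^ (m + k) *\<^sub>R word_map \<psi> v x) | k v. v \<in> words M (k + l)}"

lemma similar_copy_lift:
  assumes "v \<in> words M (k + l)" "k \<le> n"
  shows "\<exists>u\<in>words M (n + l). (\<lambda>x. L ^ (m + k) *\<^sub>R word_map \<psi> v x) = (\<lambda>x. L ^ (m + n) *\<^sub>R word_map \<psi> u x)"
proof (rule bexI)
  obtain j where n: "n = j + k" using assms(2) by (metis le_add_diff_inverse2)
  show "replicate (n - k) 1 @ v \<in> words M (n + l)"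
    using replicate_1_words[OF assms(1), of j] n by (simp add: add.assoc)
  show "(\<lambda>x. L ^ (m + k) *\<^sub>R word_map \<psi> v x)
      = (\<lambda>x. L ^ (m + n) *\<^sub>R word_map \<psi> (replicate (n - k) 1 @ v) x)"
    using n L_gt_1 by (simp add: word_map_replicate_1 power_add del: One_nat_def)
qed

lemma similar_copies_common_level:
  assumes "f \<in> similar_copies m l" "g \<in> similar_copies m l"
  obtains n u v where "u \<in> words M (n + l)" "v \<in> words M (n + l)"
    "f = (\<lambda>x. L ^ (m + n) *\<^sub>R word_map \<psi> u x)" "g = (\<lambda>x. L ^ (m + n) *\<^sub>R word_map \<psi> v x)"
proof -
  obtain k v k' v' where f: "v \<in> words M (k + l)" "f = (\<lambda>x. L ^ (m + k) *\<^sub>R word_map \<psi> v x)"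
    and g: "v' \<in> words M (k' + l)" "g = (\<lambda>x. L ^ (m + k') *\<^sub>R word_map \<psi> v' x)"
    using assms by (auto simp: similar_copies_def)
  show ?thesis
    using that similar_copy_lift[OF f(1), of "max k k'" m] similar_copy_lift[OF g(1), of "max k k'" m] f(2) g(2)
    by auto
qed

lemma similar_copies_dist:
  assumes "f \<in> similar_copies m l"
  shows "dist (f x) (f y) = (L ^ m / L ^ l) * dist x y"
proof -
  obtain k v where f: "v \<in> words M (k + l)" "f = (\<lambda>x. L ^ (m + k) *\<^sub>R word_map \<psi> v x)"
    using assms by (auto simp: similar_copies_def)
  have v: "set v \<subseteq> {1..M}" "length v = k + l" using f by (auto simp: words_def)
  have "dist (f x) (f y) = L ^ (m + k) * dist (word_map \<psi> v x) (word_map \<psi> v y)"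
    using L_gt_1 f by (simp add: dist_norm flip: scaleR_diff_right)
  then show ?thesis
    using L_gt_1 v by (simp add: word_map_similitude power_add field_simps)
qed

lemma similar_copies_disjoint:
  assumes sub: "\<And>i. i \<in> {1..M} \<Longrightarrow> \<psi> i ` G \<subseteq> G"
    and disj: "\<And>i j. i \<in> {1..M} \<Longrightarrow> j \<in> {1..M} \<Longrightarrow> i \<noteq> j \<Longrightarrow> \<psi> i ` G \<inter> \<psi> j ` G = {}"
    and f: "f \<in> similar_copies m l" "g \<in> similar_copies m l" "f \<noteq> g"
  shows "f ` G \<inter> g ` G = {}"
proof -
  obtain n u v where fg: "u \<in> words M (n + l)" "v \<in> words M (n + l)"
    "f = (\<lambda>x. L ^ (m + n) *\<^sub>R word_map \<psi> u x)" "g = (\<lambda>x. L ^ (m + n) *\<^sub>R word_map \<psi> v x)"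
    using similar_copies_common_level f by blast
  then have "u \<noteq> v" using f by auto
  then have "word_map \<psi> u ` G \<inter> word_map \<psi> v ` G = {}"
    using word_map_disjoint[OF sub disj] fg by blast
  then show ?thesis
    using fg L_gt_1 by auto
qed

text \<open>At a common level distinct maps come from distinct words of equal length, so the nesting
  axiom applies; scaling by a power of \<open>L\<close> is injective and carries it over.\<close>

lemma similar_copies_nesting:
  assumes f: "f \<in> similar_copies m l" "g \<in> similar_copies m l" "f \<noteq> g"
  shows "f ` K \<inter> g ` K \<subseteq> f ` essential_fixed_points M \<psi>"
proof -
  obtain n u v where fg: "u \<in> words M (n + l)" "v \<in> words M (n + l)"
    "f = (\<lambda>x. L ^ (m + n) *\<^sub>R word_map \<psi> u x)" "g = (\<lambda>x. L ^ (m + n) *\<^sub>R word_map \<psi> v x)"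
    using similar_copies_common_level f by blast
  then have "u \<noteq> v" using f by auto
  then have *: "word_map \<psi> u ` K \<inter> word_map \<psi> v ` K \<subseteq> word_map \<psi> u ` essential_fixed_points M \<psi>"
    using nesting[OF fg(1,2)] by blast
  show ?thesis
  proof
    fix z assume "z \<in> f ` K \<inter> g ` K"
    then obtain a b where "a \<in> K" "b \<in> K" "z = L ^ (m + n) *\<^sub>R word_map \<psi> u a" "z = L ^ (m + n) *\<^sub>R word_map \<psi> v b"
      using fg by auto
    moreover from this have "word_map \<psi> u a = word_map \<psi> v b" using L_gt_1 by auto
    ultimately have "word_map \<psi> u a \<in> word_map \<psi> u ` essential_fixed_points M \<psi>"
      using * by (metis IntI imageI subsetD)
    then show "z \<in> f ` essential_fixed_points M \<psi>"
      using \<open>z = L ^ (m + n) *\<^sub>R word_map \<psi> u a\<close> fg by auto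
  qed
qed

text \<open>Copies of any prescribed size cover the unbounded fractal: \<open>K\<close> contains its
  image under m applications of \<open>\<psi> 1\<close>, so L^n a is L^(m + n) times a point of
  \<open>K\<close>, and that point lies in some piece of level n + l.\<close>

lemma unbounded_fractal_level:
  assumes "x \<in> unbounded_fractal L K"
  obtains n v where "v \<in> words M (n + l)" "x \<in> (\<lambda>y. L ^ (m + n) *\<^sub>R word_map \<psi> v y) ` K"
proof -
  obtain n a where a: "a \<in> K" "x = L ^ n *\<^sub>R a"
    using assms by (auto simp: unbounded_fractal_def)
  have "replicate m 1 \<in> words M m"
    using M_ge_2 by (auto simp: words_def)
  then have "word_map \<psi> (replicate m 1) a \<in> K"
    using K_eq_UN_words[of m] a(1) by blast
  then have "(1 / L ^ m) *\<^sub>R a \<in> K"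
    using word_map_replicate_1[of m "[]" a] by simp
  then obtain v b where v: "v \<in> words M (n + l)" "b \<in> K" "(1 / L ^ m) *\<^sub>R a = word_map \<psi> v b"
    using K_eq_UN_words[of "n + l"] by blast
  have "x = L ^ (m + n) *\<^sub>R ((1 / L ^ m) *\<^sub>R a)"
    using a L_gt_1 by (simp add: power_add)
  then have "x = L ^ (m + n) *\<^sub>R word_map \<psi> v b"
    using v by simp
  then show ?thesis
    using that[OF v(1)] v(2) by blast
qed

lemma similar_copy_compact: "f \<in> similar_copies m l \<Longrightarrow> compact (f ` K)"
  using compact_cell by (force simp: similar_copies_def cell_def image_image words_def)

lemma cell_subset_fractal:
  assumes "set w \<subseteq> {1..M}"
  shows "cell L \<psi> K m w \<subseteq> unbounded_fractal L K"
proof -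
  have "w \<in> words M (length w)" using assms by (simp add: words_def)
  then have "word_map \<psi> w ` K \<subseteq> K" using K_eq_UN_words by blast
  then show ?thesis by (auto simp: cell_def unbounded_fractal_def)
qed

lemma finite_similar_copies_meeting:
  assumes "bounded S"
  shows "finite {f \<in> similar_copies m l. f ` K \<inter> S \<noteq> {}}"
proof -
  obtain G where G: "open G" "G \<noteq> {}" "\<And>i. i \<in> {1..M} \<Longrightarrow> \<psi> i ` G \<subseteq> G"
    "\<And>i j. i \<in> {1..M} \<Longrightarrow> j \<in> {1..M} \<Longrightarrow> i \<noteq> j \<Longrightarrow> \<psi> i ` G \<inter> \<psi> j ` G = {}"
    using open_set_condition by metis
  show ?thesis
  proof (rule locally_finite_similar_copies[where c = "L ^ m / L ^ l"])
    show "f ` G \<inter> g ` G = {}" if "f \<in> similar_copies m l" "g \<in> similar_copies m l" "f \<noteq> g" for f g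
      using similar_copies_disjoint[OF G(3,4)] that by blast
  qed (use G L_gt_1 assms K_compact in \<open>auto simp: similar_copies_dist compact_imp_bounded\<close>)
qed

text \<open>Near a point of the cell that is no vertex, only finitely many other copies of the same
  size occur. Their union is closed and misses the point by nesting, so a small ball avoids it.
  Since the copies cover the fractal, what remains of the fractal in that ball belongs to the
  cell.\<close>

lemma openin_cell_minus_boundary:
  assumes w: "set w \<subseteq> {1..M}"
  shows "openin (top_of_set (unbounded_fractal L K))
    (cell L \<psi> K m w - (\<lambda>x. L ^ m *\<^sub>R x) ` word_map \<psi> w ` essential_fixed_points M \<psi>)"
    (is "openin _ (?C - ?B)")
  unfolding openin_euclidean_subtopology_iff
proof (intro conjI ballI)
  show "?C - ?B \<subseteq> unbounded_fractal L K" using cell_subset_fractal[OF w] by blast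
  fix z assume z: "z \<in> ?C - ?B"
  define f0 where "f0 x = L ^ m *\<^sub>R word_map \<psi> w x" for x
  have f0: "f0 \<in> similar_copies m (length w)"
    unfolding similar_copies_def mem_Collect_eq
    by (rule exI[of _ 0], rule exI[of _ w]) (use w in \<open>auto simp: f0_def words_def\<close>)
  have C: "?C = f0 ` K" and B: "?B = f0 ` essential_fixed_points M \<psi>"
    by (auto simp: f0_def cell_def image_image)
  \<comment> \<open>Radius 1 is an arbitrary choice of bounded neighbourhood. It is the reason for
    \<open>min e 1\<close> below: a copy through a point within distance 1 of \<open>z\<close> is a
    member of \<open>F\<close>.\<close>
  define F where "F = {f \<in> similar_copies m (length w). f ` K \<inter> ball z 1 \<noteq> {}}"
  have "finite F" unfolding F_def by (rule finite_similar_copies_meeting) simp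
  define U where "U = (\<Union>f\<in>F - {f0}. f ` K)"
  have "closed U"
    unfolding U_def using \<open>finite F\<close>
    by (intro closed_UN ballI compact_imp_closed similar_copy_compact[of _ m "length w"]) (auto simp: F_def)
  moreover have "closed ?B"
    by (intro finite_imp_closed finite_imageI finite_essential_fixed_points)
  ultimately have "open (- (U \<union> ?B))" by (intro open_Compl closed_Un)
  moreover have "z \<notin> U"
    using z similar_copies_nesting[OF f0] unfolding U_def C B F_def by blast
  ultimately obtain e where e: "0 < e" "ball z e \<subseteq> - (U \<union> ?B)"
    using z openE[of "- (U \<union> ?B)" z] by auto
  show "\<exists>e>0. \<forall>x'\<in>unbounded_fractal L K. dist x' z < e \<longrightarrow> x' \<in> ?C - ?B"
  proof (intro exI conjI ballI impI)
    show "0 < min e 1" using e by simp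
    fix x assume x: "x \<in> unbounded_fractal L K" "dist x z < min e 1"
    then have xe: "x \<in> ball z e" "x \<in> ball z 1" by (auto simp: dist_commute)
    obtain n v where "v \<in> words M (n + length w)" "x \<in> (\<lambda>y. L ^ (m + n) *\<^sub>R word_map \<psi> v y) ` K"
      using unbounded_fractal_level[OF x(1)] by blast
    then obtain f where f: "f \<in> similar_copies m (length w)" "x \<in> f ` K"
      unfolding similar_copies_def by blast
    then have "f \<in> F" using xe by (auto simp: F_def)
    have "x \<notin> U" using xe e by blast
    then have "f = f0" using f \<open>f \<in> F\<close> by (auto simp: U_def)
    then show "x \<in> ?C - ?B" using f C xe e by blast
  qed
qed

text \<open>Subdividing a blow-up of \<open>K\<close> often enough gives small cells through each of
  its points. Every open set is therefore the union of the cells it contains, although cells need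
  not be open.\<close>

lemma small_cell_ex:
  assumes x: "x \<in> unbounded_fractal L K" and "0 < e"
  obtains C where "C \<in> cells M L \<psi> K" "x \<in> C" "C \<subseteq> ball x e"
proof -
  obtain n a where a: "a \<in> K" "x = L ^ n *\<^sub>R a"
    using x by (auto simp: unbounded_fractal_def)
  obtain R where R: "0 < R" "\<And>y z. y \<in> K \<Longrightarrow> z \<in> K \<Longrightarrow> dist y z \<le> R"
    using compact_imp_bounded[OF K_compact] bounded_two_points
    by (metis linorder_not_less order_le_less_trans zero_less_one less_eq_real_def)
  \<comment> \<open>\<open>L ^ n * R\<close> bounds the diameter of the blow-up containing
    \<open>x\<close>, and subdivision to level \<open>l\<close> divides it by
    \<open>L ^ l\<close>.\<close>
  obtain l where l: "L ^ n * R / e < L ^ l"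
    using real_arch_pow[OF L_gt_1] by blast
  obtain v b where v: "v \<in> words M l" "b \<in> K" "a = word_map \<psi> v b"
    using K_eq_UN_words[of l] a(1) by blast
  show ?thesis
  proof
    show "cell L \<psi> K n v \<in> cells M L \<psi> K" using v by (auto simp: cells_def words_def)
    show "x \<in> cell L \<psi> K n v" using a v by (auto simp: cell_def)
    show "cell L \<psi> K n v \<subseteq> ball x e"
    proof
      fix y assume "y \<in> cell L \<psi> K n v"
      then obtain c where c: "c \<in> K" "y = L ^ n *\<^sub>R word_map \<psi> v c" by (auto simp: cell_def)
      have "dist x y = L ^ n * (dist b c / L ^ l)"
        using v L_gt_1 word_map_similitude[of v b c] a c
        by (simp add: dist_norm words_def flip: scaleR_diff_right)
      also have "\<dots> \<le> L ^ n * R / L ^ l"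
        using R(2)[OF v(2) c(1)] L_gt_1 by (simp add: divide_right_mono)
      also have "\<dots> < e" using l L_gt_1 \<open>0 < e\<close> by (simp add: field_simps)
      finally show "y \<in> ball x e" by simp
    qed
  qed
qed

lemma countable_cells: "countable (cells M L \<psi> K)"
proof -
  have "cells M L \<psi> K \<subseteq> (\<lambda>(m, w). cell L \<psi> K m w) ` UNIV"
    by (auto simp: cells_def)
  then show ?thesis
    by (rule countable_subset) simp
qed

end

section \<open>Heat kernel integrals on Ahlfors regular spaces\<close>

text \<open>Separates the integral estimates from the fractal geometry: they rest on the volume
  growth of balls, with geodesics and kernel bounds supplied as explicit hypotheses where they are
  used.\<close>

locale ahlfors_space = Metric_space X d for X :: "'a set" and d +
  fixes \<mu> :: "'a measure" and dH :: real
  assumes borel: "borel_on mtopology \<mu>"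
    and ahlfors: "ahlfors_regular X d \<mu> dH"
begin

lemma space_eq: "space \<mu> = X"
  using borel by (simp add: borel_on_def)

lemma openin_sets: "openin mtopology U \<Longrightarrow> U \<in> sets \<mu>"
  using borel by (auto simp: borel_on_def)

lemma mball_sets [measurable]: "mball x r \<in> sets \<mu>"
  by (rule openin_sets) simp

lemma dH_pos: "0 < dH"
  using ahlfors by (simp add: ahlfors_regular_def)

lemma ball_bounds:
  obtains c1 c2 where "0 < c1" "0 < c2"
    "\<And>x r. x \<in> X \<Longrightarrow> 0 \<le> r \<Longrightarrow> ennreal (c1 * r powr dH) \<le> emeasure \<mu> (mball x r)"
    "\<And>x r. x \<in> X \<Longrightarrow> 0 \<le> r \<Longrightarrow> emeasure \<mu> (mball x r) \<le> ennreal (c2 * r powr dH)"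
  using ahlfors unfolding ahlfors_regular_def by blast

lemma emeasure_mball_finite: "emeasure \<mu> (mball x r) < \<infinity>"
proof (cases "x \<in> X \<and> 0 \<le> r")
  case True
  obtain c2 where "emeasure \<mu> (mball x r) \<le> ennreal (c2 * r powr dH)"
    using ball_bounds True by metis
  then show ?thesis using ennreal_less_top order_le_less_trans by (metis infinity_ennreal_def)
next
  case False
  then have "mball x r = {}" by (auto simp: mball_eq_empty)
  then show ?thesis by simp
qed

lemma sigma_finite: "sigma_finite_measure \<mu>"
proof
  show "\<exists>A. countable A \<and> A \<subseteq> sets \<mu> \<and> \<Union> A = space \<mu> \<and> (\<forall>a\<in>A. emeasure \<mu> a \<noteq> \<infinity>)"
  proof (cases "X = {}")
    case True
    then show ?thesis by (intro exI[of _ "{}"]) (simp add: space_eq)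
  next
    case False
    then obtain a where "a \<in> X" by blast
    have "x \<in> (\<Union>n. mball a (real n))" if "x \<in> X" for x
      using that \<open>a \<in> X\<close> reals_Archimedean2[of "d a x"] by auto
    then have "(\<Union>n. mball a (real n)) = X" by auto
    then show ?thesis
      using emeasure_mball_finite
      by (intro exI[of _ "range (\<lambda>n. mball a (real n))"]) (auto simp: space_eq less_top)
  qed
qed

lemma emeasure_space_infinite:
  assumes "X \<noteq> {}"
  shows "emeasure \<mu> X = \<infinity>"
proof (rule ccontr)
  assume "emeasure \<mu> X \<noteq> \<infinity>"
  then obtain m where m: "emeasure \<mu> X = ennreal m" "0 \<le> m"
    by (metis ennreal_cases infinity_ennreal_def)
  obtain a where "a \<in> X" using assms by blast
  obtain c1 where c1: "0 < c1" "\<And>r. 0 \<le> r \<Longrightarrow> ennreal (c1 * r powr dH) \<le> emeasure \<mu> (mball a r)"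
    using ball_bounds \<open>a \<in> X\<close> by metis
  \<comment> \<open>Chosen so that the lower volume bound for this ball is m + 1, more than the
    supposed total mass.\<close>
  define r where "r = ((m + 1) / c1) powr (1 / dH)"
  have "r powr dH = (m + 1) / c1"
    using dH_pos m c1 by (simp add: r_def powr_powr)
  then have "ennreal (m + 1) \<le> emeasure \<mu> (mball a r)"
    using c1(2)[of r] c1(1) by (simp add: r_def)
  also have "\<dots> \<le> emeasure \<mu> X"
    using openin_sets[OF openin_topspace] by (intro emeasure_mono) (auto simp: mball_subset_mspace)
  also have "\<dots> = ennreal m" by (rule m)
  finally show False using m by simp
qed

lemma measurable_dist:
  assumes "b \<in> X"
  shows "(\<lambda>x. d x b) \<in> borel_measurable \<mu>"
  unfolding borel_measurable_iff_less
proof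
  fix r
  have "{x \<in> space \<mu>. d x b < r} = mball b r"
    using assms by (auto simp: space_eq commute)
  then show "{x \<in> space \<mu>. d x b < r} \<in> sets \<mu>" by simp
qed

text \<open>Measure distances in units of \<open>R\<close> = t^(1/dW). Where d x b / R lies between
  n and n + 1, the integrand is at most exp(- c n), and that region has volume at most c2 ((n + 1)
  R)^dH. The sum over n converges and leaves the factor R^dH = t^(dH/dW).\<close>

lemma sub_Gaussian_integral_bound:
  assumes "0 < c" "1 < dW"
  obtains C where "0 < C" "\<And>b t. b \<in> X \<Longrightarrow> 0 < t \<Longrightarrow>
    (\<integral>\<^sup>+x. ennreal (exp (- c * ((d x b powr dW) / t) powr (1 / (dW - 1)))) \<partial>\<mu>)
      \<le> ennreal (C * t powr (dH / dW))"
proof -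
  obtain c2 where c2: "0 < c2" "\<And>x r. x \<in> X \<Longrightarrow> 0 \<le> r \<Longrightarrow> emeasure \<mu> (mball x r) \<le> ennreal (c2 * r powr dH)"
    using ball_bounds by metis
  define S where "S n = exp (- c * real n) * (real n + 1) powr dH" for n
  have Spos: "0 < S n" for n by (simp add: S_def)
  have "S \<in> O(\<lambda>n. inverse (real n ^ 2))"
    unfolding S_def using \<open>0 < c\<close> by real_asymp
  moreover have "summable (\<lambda>n. norm (inverse (real n ^ 2)))"
    using inverse_power_summable[of 2, where 'a = real] by (simp only: norm_inverse norm_power norm_of_nat)
  ultimately have sS: "summable S"
    by (rule summable_comparison_test_bigo[rotated])
  have term_le: "f n \<le> suminf f" for f :: "nat \<Rightarrow> ennreal" and n
    using sum_le_suminf[of f "{n}"] by simp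
  show ?thesis
  proof (rule that[of "c2 * suminf S"])
    show "0 < c2 * suminf S"
      using c2 suminf_pos[OF sS] Spos by simp
    fix b t assume b: "b \<in> X" and t: "0 < (t::real)"
    define R where "R = t powr (1 / dW)"
    have R: "0 < R" using t by (simp add: R_def)
    have RW: "R powr dW = t" using t assms by (simp add: R_def powr_powr)
    \<comment> \<open>Whole balls replace the annuli: the term of index n already dominates the
      integrand, and the others only add to the bound.\<close>
    have pw: "ennreal (exp (- c * ((d x b powr dW) / t) powr (1 / (dW - 1))))
       \<le> (\<Sum>n. ennreal (exp (- c * real n)) * indicator (mball b ((real n + 1) * R)) x)"
      if x: "x \<in> X" for x
    proof -
      define n where "n = nat \<lfloor>d x b / R\<rfloor>"
      have n: "real n \<le> d x b / R" "d x b / R < real n + 1"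
        using R by (simp_all add: n_def)
      \<comment> \<open>The total exponent dW / (dW - 1) exceeds 1, so raising a number at least 1
        to it does not decrease it; index 0 is treated apart.\<close>
      have "real n \<le> ((d x b powr dW) / t) powr (1 / (dW - 1))"
      proof (cases "n = 0")
        case False
        then have n1: "1 \<le> real n" by simp
        have "real n powr 1 \<le> real n powr (dW * (1 / (dW - 1)))"
          using n1 assms by (intro powr_mono) (auto simp: field_simps)
        also have "\<dots> = (real n powr dW) powr (1 / (dW - 1))"
          by (simp add: powr_powr)
        also have "\<dots> \<le> ((d x b / R) powr dW) powr (1 / (dW - 1))"
          using n n1 assms by (intro powr_mono2) auto
        also have "(d x b / R) powr dW = d x b powr dW / t"
          using R RW by (simp add: powr_divide)
        finally show ?thesis using n1 by simp
      qed simp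
      then have "ennreal (exp (- c * ((d x b powr dW) / t) powr (1 / (dW - 1)))) \<le> ennreal (exp (- c * real n))"
        using \<open>0 < c\<close> by (intro ennreal_leI) simp
      also have "\<dots> = ennreal (exp (- c * real n)) * indicator (mball b ((real n + 1) * R)) x"
        using n R x b by (simp add: field_simps commute)
      also have "\<dots> \<le> (\<Sum>n. ennreal (exp (- c * real n)) * indicator (mball b ((real n + 1) * R)) x)"
        by (rule term_le)
      finally show ?thesis .
    qed
    have "(\<integral>\<^sup>+x. ennreal (exp (- c * ((d x b powr dW) / t) powr (1 / (dW - 1)))) \<partial>\<mu>)
      \<le> (\<integral>\<^sup>+x. (\<Sum>n. ennreal (exp (- c * real n)) * indicator (mball b ((real n + 1) * R)) x) \<partial>\<mu>)"
      by (intro nn_integral_mono pw) (simp add: space_eq)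
    also have "\<dots> = (\<Sum>n. ennreal (exp (- c * real n)) * emeasure \<mu> (mball b ((real n + 1) * R)))"
      by (simp add: nn_integral_suminf nn_integral_cmult)
    also have "\<dots> \<le> (\<Sum>n. ennreal (c2 * R powr dH * S n))"
    proof (intro suminf_le allI summableI)
      fix n
      have "ennreal (exp (- c * real n)) * emeasure \<mu> (mball b ((real n + 1) * R))
         \<le> ennreal (exp (- c * real n)) * ennreal (c2 * ((real n + 1) * R) powr dH)"
        using c2(2)[OF b] R by (intro mult_left_mono) auto
      also have "\<dots> = ennreal (c2 * R powr dH * S n)"
        using c2(1) R by (simp add: S_def powr_mult mult_ac flip: ennreal_mult)
      finally show "ennreal (exp (- c * real n)) * emeasure \<mu> (mball b ((real n + 1) * R))
         \<le> ennreal (c2 * R powr dH * S n)" .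
    qed
    also have "\<dots> = ennreal (\<Sum>n. c2 * R powr dH * S n)"
      using c2(1) Spos by (intro suminf_ennreal2 summable_mult sS) (simp add: less_imp_le)
    also have "(\<Sum>n. c2 * R powr dH * S n) = c2 * suminf S * t powr (dH / dW)"
      using suminf_mult[OF sS, of "c2 * R powr dH"] by (simp add: R_def powr_powr mult_ac)
    finally show "(\<integral>\<^sup>+x. ennreal (exp (- c * ((d x b powr dW) / t) powr (1 / (dW - 1)))) \<partial>\<mu>)
      \<le> ennreal (c2 * suminf S * t powr (dH / dW))" .
  qed
qed

end

section \<open>Functions jumping across finitely many points\<close>

context ahlfors_space
begin

text \<open>The equation says that \<open>b\<close> lies metrically between \<open>x\<close> and
  \<open>y\<close>: every change of value has to pass one of finitely many gates. No continuity or
  measurability is encoded; integrability is asked for separately.\<close>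

definition finite_cut :: "('a \<Rightarrow> real) \<Rightarrow> bool" where
  "finite_cut g \<longleftrightarrow> (\<exists>M. \<forall>x\<in>X. \<bar>g x\<bar> \<le> M) \<and>
     (\<exists>B. finite B \<and> B \<subseteq> X \<and> (\<forall>x\<in>X. \<forall>y\<in>X. g x \<noteq> g y \<longrightarrow> (\<exists>b\<in>B. d x y = d x b + d b y)))"

text \<open>If the combined values differ, then one of the two functions already differs, so the
  union of the two cut sets serves.\<close>

lemma finite_cut_combine:
  assumes "finite_cut g" "finite_cut h" and bdd: "\<And>x. x \<in> X \<Longrightarrow> \<bar>\<phi> (g x) (h x)\<bar> \<le> M"
  shows "finite_cut (\<lambda>x. \<phi> (g x) (h x))"
proof -
  obtain A where A: "finite A" "A \<subseteq> X" "\<And>x y. x \<in> X \<Longrightarrow> y \<in> X \<Longrightarrow> g x \<noteq> g y \<Longrightarrow> \<exists>b\<in>A. d x y = d x b + d b y"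
    using assms(1) unfolding finite_cut_def by blast
  obtain B where B: "finite B" "B \<subseteq> X" "\<And>x y. x \<in> X \<Longrightarrow> y \<in> X \<Longrightarrow> h x \<noteq> h y \<Longrightarrow> \<exists>b\<in>B. d x y = d x b + d b y"
    using assms(2) unfolding finite_cut_def by blast
  have "\<exists>b\<in>A \<union> B. d x y = d x b + d b y"
    if "x \<in> X" "y \<in> X" "\<phi> (g x) (h x) \<noteq> \<phi> (g y) (h y)" for x y
    using that A(3)[of x y] B(3)[of x y] by (metis UnCI)
  then show ?thesis
    unfolding finite_cut_def using A B bdd by (intro conjI exI[of _ M] exI[of _ "A \<union> B"]) auto
qed

lemma finite_cut_add:
  assumes "finite_cut g" "finite_cut h"
  shows "finite_cut (\<lambda>x. g x + h x)"
proof -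
  obtain M N where "\<And>x. x \<in> X \<Longrightarrow> \<bar>g x\<bar> \<le> M" "\<And>x. x \<in> X \<Longrightarrow> \<bar>h x\<bar> \<le> N"
    using assms unfolding finite_cut_def by blast
  then have "\<bar>g x + h x\<bar> \<le> M + N" if "x \<in> X" for x
    using that by (meson abs_triangle_ineq add_mono order_trans)
  then show ?thesis using finite_cut_combine[OF assms, of "(+)"] by blast
qed

lemma finite_cut_scale:
  assumes "finite_cut g"
  shows "finite_cut (\<lambda>x. c * g x)"
proof -
  obtain M where "\<And>x. x \<in> X \<Longrightarrow> \<bar>g x\<bar> \<le> M"
    using assms unfolding finite_cut_def by blast
  then have "\<bar>c * g x\<bar> \<le> \<bar>c\<bar> * M" if "x \<in> X" for x
    using that by (simp add: abs_mult mult_left_mono)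
  then show ?thesis using finite_cut_combine[OF assms assms, of "\<lambda>u v. c * u"] by blast
qed

lemma finite_cut_indicator_empty: "finite_cut (indicator {})"
  unfolding finite_cut_def by (intro conjI exI[of _ 1] exI[of _ "{}"]) auto

lemma finite_cut_indicator_Un:
  assumes "finite_cut (indicator A)" "finite_cut (indicator B)"
  shows "finite_cut (indicator (A \<union> B))"
proof -
  have "indicator (A \<union> B) = (\<lambda>x. max (indicator A x) (indicator B x :: real))"
    by (auto simp: indicator_def)
  then show ?thesis
    using finite_cut_combine[OF assms, of max 1] by (simp add: indicator_def)
qed

lemma finite_cut_indicator_UN:
  assumes "finite I" "\<And>i. i \<in> I \<Longrightarrow> finite_cut (indicator (A i))"
  shows "finite_cut (indicator (\<Union>i\<in>I. A i))"
  using assms by (induction I) (auto simp: finite_cut_indicator_empty finite_cut_indicator_Un)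

text \<open>Neither \<open>d x b\<close> nor \<open>d y b\<close> exceeds \<open>d x y\<close>, so
  each of the two exponents on the right is at most half of the exponent on the left.\<close>

lemma sub_Gaussian_cut_bound:
  assumes "0 < c" "1 < dW" "0 < t" "x \<in> X" "y \<in> X" "b \<in> X" "d x y = d x b + d b y"
  shows "exp (- (2 * c) * ((d x y powr dW) / t) powr (1 / (dW - 1)))
    \<le> exp (- c * ((d x b powr dW) / t) powr (1 / (dW - 1))) * exp (- c * ((d y b powr dW) / t) powr (1 / (dW - 1)))"
proof -
  have m: "((r powr dW) / t) powr (1 / (dW - 1)) \<le> ((d x y powr dW) / t) powr (1 / (dW - 1))"
    if "0 \<le> r" "r \<le> d x y" for r
    using that assms(2,3) by (intro powr_mono2 divide_right_mono) auto
  have "c * ((d x b powr dW) / t) powr (1 / (dW - 1)) \<le> c * ((d x y powr dW) / t) powr (1 / (dW - 1))"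
    "c * ((d y b powr dW) / t) powr (1 / (dW - 1)) \<le> c * ((d x y powr dW) / t) powr (1 / (dW - 1))"
    using assms m[of "d x b"] m[of "d y b"] commute[of b y] nonneg[of x b] nonneg[of b y] by simp_all
  then show ?thesis by (simp flip: exp_add)
qed

text \<open>The powers of \<open>t\<close> balance at this exponent: t^(- dH/dW) from the kernel and
  the same power from the seminorm cancel two integrals of order t^(dH/dW). The bound is therefore
  the same for small and for large \<open>t\<close>.\<close>

lemma finite_cut_besov1:
  assumes g: "finite_cut g" "integrable \<mu> g" and p: "sub_Gaussian_bounds \<mu> d p dH dW"
  shows "g \<in> besov1 \<mu> p (dH / dW)"
proof -
  interpret sf: sigma_finite_measure \<mu> by (rule sigma_finite)
  interpret pf: pair_sigma_finite \<mu> \<mu> by standard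
  obtain M where M0: "\<And>x. x \<in> X \<Longrightarrow> \<bar>g x\<bar> \<le> M"
    using g(1) unfolding finite_cut_def by blast
  \<comment> \<open>The absolute value keeps \<open>N\<close> nonnegative even if \<open>X\<close>
    is empty, when \<open>M\<close> may be negative.\<close>
  define N where "N = \<bar>2 * M\<bar>"
  have N: "0 \<le> N" "\<And>x y. x \<in> X \<Longrightarrow> y \<in> X \<Longrightarrow> \<bar>g x - g y\<bar> \<le> N"
    using M0 unfolding N_def by (simp, smt (verit))
  obtain B where B: "finite B" "B \<subseteq> X"
    "\<And>x y. x \<in> X \<Longrightarrow> y \<in> X \<Longrightarrow> g x \<noteq> g y \<Longrightarrow> \<exists>b\<in>B. d x y = d x b + d b y"
    using g(1) unfolding finite_cut_def by blast
  have dW: "1 < dW" using p by (simp add: sub_Gaussian_bounds_def)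
  obtain c3 c4 where c: "0 < c3" "0 < c4" and ub: "\<And>t. 0 < t \<Longrightarrow> AE (x, y) in \<mu> \<Otimes>\<^sub>M \<mu>.
      p t x y \<le> c3 * t powr (- dH / dW) * exp (- c4 * ((d x y powr dW) / t) powr (1 / (dW - 1)))"
  proof -
    obtain c3 c4 c5 c6 where "0 < c3" "0 < c4" and *: "\<And>t. 0 < t \<Longrightarrow> AE (x, y) in \<mu> \<Otimes>\<^sub>M \<mu>.
        c5 * t powr (- dH / dW) * exp (- c6 * ((d x y powr dW) / t) powr (1 / (dW - 1))) \<le> p t x y \<and>
        p t x y \<le> c3 * t powr (- dH / dW) * exp (- c4 * ((d x y powr dW) / t) powr (1 / (dW - 1)))"
      using p unfolding sub_Gaussian_bounds_def by blast
    show ?thesis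
    proof (rule that[OF \<open>0 < c3\<close> \<open>0 < c4\<close>])
      fix t :: real assume "0 < t"
      show "AE (x, y) in \<mu> \<Otimes>\<^sub>M \<mu>. p t x y \<le> c3 * t powr (- dH / dW) * exp (- c4 * ((d x y powr dW) / t) powr (1 / (dW - 1)))"
        using *[OF \<open>0 < t\<close>] by eventually_elim auto
    qed
  qed
  \<comment> \<open>Half of \<open>c4\<close>, since the Gaussian factor is to be split between the
    two variables.\<close>
  obtain C where C: "0 < C" "\<And>b t. b \<in> X \<Longrightarrow> 0 < t \<Longrightarrow>
    (\<integral>\<^sup>+x. ennreal (exp (- (c4 / 2) * ((d x b powr dW) / t) powr (1 / (dW - 1)))) \<partial>\<mu>)
      \<le> ennreal (C * t powr (dH / dW))"
    using sub_Gaussian_integral_bound[of "c4 / 2" dW] c dW by auto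
  have bound: "ennreal (t powr (- (dH / dW))) * (\<integral>\<^sup>+x. (\<integral>\<^sup>+y. ennreal (\<bar>g x - g y\<bar> * p t x y) \<partial>\<mu>) \<partial>\<mu>)
      \<le> ennreal (real (card B) * (N * c3 * C\<^sup>2))" if t: "0 < t" for t
  proof -
    define h where "h b x = exp (- (c4 / 2) * ((d x b powr dW) / t) powr (1 / (dW - 1)))" for b x
    define a where "a = N * c3 * t powr (- (dH / dW))"
    have "0 \<le> a" using N c by (simp add: a_def)
    have hm [measurable]: "(\<lambda>x. ennreal (h b x)) \<in> borel_measurable \<mu>" if "b \<in> B" for b
      unfolding h_def using measurable_dist[OF subsetD[OF B(2) that]] by measurable
    \<comment> \<open>The separating point depends on \<open>x\<close> and \<open>y\<close>. Summing
      over all of \<open>B\<close> gives a majorant free of this choice, each term being a product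
      of a function of \<open>x\<close> and a function of \<open>y\<close>.\<close>
    have pt: "ennreal (\<bar>g x - g y\<bar> * p t x y) \<le> (\<Sum>b\<in>B. ennreal a * (ennreal (h b x) * ennreal (h b y)))"
      if xy: "x \<in> X" "y \<in> X" and
        le: "p t x y \<le> c3 * t powr (- dH / dW) * exp (- c4 * ((d x y powr dW) / t) powr (1 / (dW - 1)))"
      for x y
    proof (cases "g x = g y")
      case False
      then obtain b where b: "b \<in> B" "d x y = d x b + d b y" using B xy by blast
      have "p t x y \<le> c3 * t powr (- (dH / dW)) * (h b x * h b y)"
      proof -
        have "exp (- c4 * ((d x y powr dW) / t) powr (1 / (dW - 1))) \<le> h b x * h b y"
          using sub_Gaussian_cut_bound[of "c4 / 2" dW t x y b] b B(2) xy c t dW by (auto simp: h_def)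
        then have "c3 * t powr (- (dH / dW)) * exp (- c4 * ((d x y powr dW) / t) powr (1 / (dW - 1)))
          \<le> c3 * t powr (- (dH / dW)) * (h b x * h b y)"
          using c by (intro mult_left_mono) auto
        then show ?thesis using le by simp
      qed
      then have "\<bar>g x - g y\<bar> * p t x y \<le> N * (c3 * t powr (- (dH / dW)) * (h b x * h b y))"
      proof -
        have "\<bar>g x - g y\<bar> * p t x y \<le> \<bar>g x - g y\<bar> * (c3 * t powr (- (dH / dW)) * (h b x * h b y))"
          by (rule mult_left_mono) (fact, simp)
        also have "\<dots> \<le> N * (c3 * t powr (- (dH / dW)) * (h b x * h b y))"
          using N(2)[OF xy] c by (intro mult_right_mono) (auto simp: h_def)
        finally show ?thesis by (simp add: mult_ac)
      qed
      also have "\<dots> = a * (h b x * h b y)" by (simp add: a_def)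
      finally have "ennreal (\<bar>g x - g y\<bar> * p t x y) \<le> ennreal a * (ennreal (h b x) * ennreal (h b y))"
        using \<open>0 \<le> a\<close> by (simp add: h_def ennreal_leI flip: ennreal_mult)
      also have "\<dots> \<le> (\<Sum>b\<in>B. ennreal a * (ennreal (h b x) * ennreal (h b y)))"
        using b B by (intro member_le_sum) auto
      finally show ?thesis .
    qed simp
    \<comment> \<open>The kernel bound is given almost everywhere for the product measure, whereas
      the seminorm is an iterated integral.\<close>
    have "AE x in \<mu>. AE y in \<mu>. p t x y \<le> c3 * t powr (- dH / dW) * exp (- c4 * ((d x y powr dW) / t) powr (1 / (dW - 1)))"
      using pf.AE_pair[OF ub[OF t]] by simp
    then have "(\<integral>\<^sup>+x. (\<integral>\<^sup>+y. ennreal (\<bar>g x - g y\<bar> * p t x y) \<partial>\<mu>) \<partial>\<mu>)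
       \<le> (\<integral>\<^sup>+x. (\<integral>\<^sup>+y. (\<Sum>b\<in>B. ennreal a * (ennreal (h b x) * ennreal (h b y))) \<partial>\<mu>) \<partial>\<mu>)"
    proof (intro nn_integral_mono_AE, elim AE_mp, intro AE_I2 impI)
      fix x assume x: "x \<in> space \<mu>"
        "AE y in \<mu>. p t x y \<le> c3 * t powr (- dH / dW) * exp (- c4 * ((d x y powr dW) / t) powr (1 / (dW - 1)))"
      show "(\<integral>\<^sup>+y. ennreal (\<bar>g x - g y\<bar> * p t x y) \<partial>\<mu>)
         \<le> (\<integral>\<^sup>+y. (\<Sum>b\<in>B. ennreal a * (ennreal (h b x) * ennreal (h b y))) \<partial>\<mu>)"
        using x(2) by (intro nn_integral_mono_AE, elim AE_mp) (use x(1) pt in \<open>auto simp: space_eq\<close>)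
    qed
    also have "\<dots> = (\<Sum>b\<in>B. ennreal a * ((\<integral>\<^sup>+x. ennreal (h b x) \<partial>\<mu>) * (\<integral>\<^sup>+y. ennreal (h b y) \<partial>\<mu>)))"
      by (simp add: nn_integral_sum nn_integral_cmult nn_integral_multc)
    also have "\<dots> \<le> (\<Sum>b\<in>B. ennreal a * (ennreal (C * t powr (dH / dW)) * ennreal (C * t powr (dH / dW))))"
      using C(2)[OF _ t] B(2) unfolding h_def by (intro sum_mono mult_left_mono mult_mono) auto
    also have "\<dots> = ennreal (real (card B) * (a * (C * t powr (dH / dW) * (C * t powr (dH / dW)))))"
      using C(1) \<open>0 \<le> a\<close> by (simp add: ennreal_of_nat_eq_real_of_nat flip: ennreal_mult)
    finally have "ennreal (t powr (- (dH / dW))) * (\<integral>\<^sup>+x. (\<integral>\<^sup>+y. ennreal (\<bar>g x - g y\<bar> * p t x y) \<partial>\<mu>) \<partial>\<mu>)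
      \<le> ennreal (t powr (- (dH / dW))) * ennreal (real (card B) * (a * (C * t powr (dH / dW) * (C * t powr (dH / dW)))))"
      by (rule mult_left_mono) simp
    also have "\<dots> = ennreal (real (card B) * (N * c3 * C\<^sup>2))"
    proof -
      have "t powr (- (dH / dW)) * t powr (dH / dW) = 1" using t by (simp flip: powr_add)
      then have "t powr (- (dH / dW)) * (real (card B) * (a * (C * t powr (dH / dW) * (C * t powr (dH / dW)))))
         = real (card B) * (N * c3 * C\<^sup>2)"
        unfolding a_def power2_eq_square by algebra
      moreover have "0 \<le> real (card B) * (a * (C * t powr (dH / dW) * (C * t powr (dH / dW))))"
        using C(1) \<open>0 \<le> a\<close> by simp
      ultimately show ?thesis by (metis ennreal_mult powr_ge_zero)
    qed
    finally show ?thesis .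
  qed
  have "besov_seminorm1 \<mu> p (dH / dW) g \<le> ennreal (real (card B) * (N * c3 * C\<^sup>2))"
    unfolding besov_seminorm1_def by (rule SUP_least) (use bound in auto)
  then show ?thesis
    using g(2) by (auto simp: besov1_def intro: order_le_less_trans)
qed

text \<open>Outer regularity encloses \<open>A\<close> in an open \<open>U\<close> of nearly the
  same mass, and \<open>U\<close> is a countable union of members of \<open>\<C>\<close>. Continuity
  of the measure lets a finite partial union fill \<open>U\<close> up to \<epsilon> / 2.\<close>

lemma finite_cut_approx_indicator:
  assumes outer: "\<And>A. A \<in> sets \<mu> \<Longrightarrow> emeasure \<mu> A = (INF U\<in>{U. openin mtopology U \<and> A \<subseteq> U}. emeasure \<mu> U)"
    and \<C>: "countable \<C>" "\<C> \<subseteq> sets \<mu>" "\<And>C. C \<in> \<C> \<Longrightarrow> finite_cut (indicator C)"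
    and base: "\<And>U x. openin mtopology U \<Longrightarrow> x \<in> U \<Longrightarrow> \<exists>C\<in>\<C>. x \<in> C \<and> C \<subseteq> U"
    and A: "A \<in> sets \<mu>" "emeasure \<mu> A < \<infinity>" and "0 < \<epsilon>"
  obtains F where "F \<in> sets \<mu>" "emeasure \<mu> F < \<infinity>" "finite_cut (indicator F)"
    "(\<integral>x. \<bar>indicator A x - indicator F x\<bar> \<partial>\<mu>) < (\<epsilon> :: real)"
proof -
  have "emeasure \<mu> A < emeasure \<mu> A + ennreal (\<epsilon> / 2)"
    using A \<open>0 < \<epsilon>\<close> by (simp add: less_top ennreal_add_left_cancel_less[of _ 0, simplified])
  then obtain U where U: "openin mtopology U" "A \<subseteq> U" "emeasure \<mu> U < emeasure \<mu> A + ennreal (\<epsilon> / 2)"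
    using outer[OF A(1)] by (auto simp: INF_less_iff)
  have [measurable]: "U \<in> sets \<mu>" "A \<in> sets \<mu>" using openin_sets U A by auto
  have Ufin: "emeasure \<mu> U < \<infinity>"
    using U(3) A(2) by (metis ennreal_less_top ennreal_add_less_top infinity_ennreal_def order_less_trans)
  \<comment> \<open>The empty set is added so that there is something to enumerate even when no
    member of \<open>\<C>\<close> lies in \<open>U\<close>.\<close>
  define E where "E = from_nat_into (insert {} {C \<in> \<C>. C \<subseteq> U})"
  have rE: "range E = insert {} {C \<in> \<C>. C \<subseteq> U}"
    unfolding E_def using \<C>(1) by (intro range_from_nat_into) auto
  have E: "E i = {} \<or> E i \<in> \<C> \<and> E i \<subseteq> U" for i
    using rangeI[of E i] unfolding rE by simp
  have EU: "E i \<subseteq> U" for i using E[of i] by auto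
  have Esets: "E i \<in> sets \<mu>" for i using E[of i] \<C>(2) by auto
  have Ecut: "finite_cut (indicator (E i))" for i
    using E[of i] \<C>(3) finite_cut_indicator_empty by auto
  have UE: "(\<Union>n. \<Union>i<n. E i) = U"
  proof
    show "(\<Union>n. \<Union>i<n. E i) \<subseteq> U" using EU by blast
    show "U \<subseteq> (\<Union>n. \<Union>i<n. E i)"
    proof
      fix x assume "x \<in> U"
      then obtain C where "C \<in> \<C>" "x \<in> C" "C \<subseteq> U" using base U by blast
      then have "C \<in> range E" using rE by blast
      then obtain i where "C = E i" by blast
      then show "x \<in> (\<Union>n. \<Union>i<n. E i)" using \<open>x \<in> C\<close> by blast
    qed
  qed
  define F where "F n = (\<Union>i<n. E i)" for n
  have Fs [measurable]: "F n \<in> sets \<mu>" for n unfolding F_def using Esets by auto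
  have FU: "F n \<subseteq> U" for n unfolding F_def using EU by blast
  have subfin: "emeasure \<mu> Y < \<infinity>" if "Y \<subseteq> U" for Y
    using emeasure_mono[OF that \<open>U \<in> sets \<mu>\<close>] Ufin by (rule order_le_less_trans)
  then have Ffin: "emeasure \<mu> (F n) < \<infinity>" for n using FU by blast
  have "(\<lambda>n. measure \<mu> (F n)) \<longlonglongrightarrow> measure \<mu> (\<Union>n. F n)"
  proof (rule Lim_measure_incseq)
    show "incseq F" unfolding F_def by (intro monoI UN_mono) auto
    show "range F \<subseteq> sets \<mu>" using Fs by auto
    show "emeasure \<mu> (\<Union>n. F n) \<noteq> \<infinity>" using Ufin UE by (simp add: F_def)
  qed
  then have "(\<lambda>n. measure \<mu> (F n)) \<longlonglongrightarrow> measure \<mu> U" using UE by (simp add: F_def)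
  then obtain n where n: "dist (measure \<mu> (F n)) (measure \<mu> U) < \<epsilon> / 2"
    using \<open>0 < \<epsilon>\<close> unfolding lim_sequentially by (meson half_gt_zero order_refl)
  have UA: "measure \<mu> U < measure \<mu> A + \<epsilon> / 2"
    using U(3) A(2) Ufin \<open>0 < \<epsilon>\<close>
    by (simp add: emeasure_eq_ennreal_measure less_top ennreal_less_iff flip: ennreal_plus)
  \<comment> \<open>Both \<open>A\<close> and \<open>F n\<close> lie in \<open>U\<close>, so a point
    where their indicators differ is missing from one of them inside \<open>U\<close>.\<close>
  have "(\<integral>x. \<bar>indicator A x - indicator (F n) x\<bar> \<partial>\<mu>)
     \<le> (\<integral>x. indicator (U - A) x + indicator (U - F n) x \<partial>\<mu> :: real)"
  proof (rule integral_mono)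
    show "integrable \<mu> (\<lambda>x. \<bar>indicator A x - indicator (F n) x\<bar> :: real)"
      using A Ffin[of n] by (intro integrable_abs Bochner_Integration.integrable_diff integrable_real_indicator) (auto simp: less_top)
    have "emeasure \<mu> (U - Y) < \<infinity>" for Y
      by (rule subfin) blast
    then show "integrable \<mu> (\<lambda>x. indicator (U - A) x + indicator (U - F n) x :: real)"
      by (intro Bochner_Integration.integrable_add integrable_real_indicator) (auto simp: less_top)
  qed (use U(2) FU[of n] in \<open>auto simp: indicator_def\<close>)
  also have "\<dots> = measure \<mu> (U - A) + measure \<mu> (U - F n)"
  proof (subst Bochner_Integration.integral_add)
    have "emeasure \<mu> (U - Y) < \<infinity>" for Y
      by (rule subfin) blast
    then show "integrable \<mu> (indicator (U - A) :: _ \<Rightarrow> real)" "integrable \<mu> (indicator (U - F n) :: _ \<Rightarrow> real)"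
      by (auto intro!: integrable_real_indicator simp: less_top)
    have "(U - Y) \<inter> space \<mu> = U - Y" for Y
      using sets.sets_into_space[OF \<open>U \<in> sets \<mu>\<close>] by blast
    then show "integral\<^sup>L \<mu> (indicator (U - A)) + integral\<^sup>L \<mu> (indicator (U - F n))
      = measure \<mu> (U - A) + measure \<mu> (U - F n)"
      by simp
  qed
  also have "measure \<mu> (U - A) = measure \<mu> U - measure \<mu> A"
    using U(2) Ufin by (intro measure_Diff) (auto simp: less_top)
  also have "measure \<mu> (U - F n) = measure \<mu> U - measure \<mu> (F n)"
    using FU Ufin by (intro measure_Diff) (auto simp: less_top)
  also have "measure \<mu> U - measure \<mu> A + (measure \<mu> U - measure \<mu> (F n)) < \<epsilon>"
    using UA n unfolding dist_real_def by linarith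
  finally have "(\<integral>x. \<bar>indicator A x - indicator (F n) x\<bar> \<partial>\<mu>) < \<epsilon>" .
  then show ?thesis
    using that[of "F n"] Fs Ffin finite_cut_indicator_UN[of "{..<n}" E] Ecut by (simp add: F_def)
qed

text \<open>Indicators generate all integrable functions through sums and dominated limits. Scaling
  and adding preserve finite cuts, and in a limit it suffices to approximate one late member of the
  sequence.\<close>

lemma finite_cut_approx:
  assumes outer: "\<And>A. A \<in> sets \<mu> \<Longrightarrow> emeasure \<mu> A = (INF U\<in>{U. openin mtopology U \<and> A \<subseteq> U}. emeasure \<mu> U)"
    and \<C>: "countable \<C>" "\<C> \<subseteq> sets \<mu>" "\<And>C. C \<in> \<C> \<Longrightarrow> finite_cut (indicator C)"
    and base: "\<And>U x. openin mtopology U \<Longrightarrow> x \<in> U \<Longrightarrow> \<exists>C\<in>\<C>. x \<in> C \<and> C \<subseteq> U"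
    and f: "integrable \<mu> f"
  shows "0 < \<epsilon> \<Longrightarrow> \<exists>g. integrable \<mu> g \<and> finite_cut g \<and> (\<integral>x. \<bar>f x - g x\<bar> \<partial>\<mu>) < (\<epsilon> :: real)"
  using f
proof (induction arbitrary: \<epsilon> rule: integrable_induct)
  case (base A c)
  \<comment> \<open>The summand 1 covers c = 0 and makes the final inequality strict.\<close>
  have "0 < \<epsilon> / (\<bar>c\<bar> + 1)" using base.prems by simp
  then obtain F where F: "F \<in> sets \<mu>" "emeasure \<mu> F < \<infinity>" "finite_cut (indicator F)"
    "(\<integral>x. \<bar>indicator A x - indicator F x\<bar> \<partial>\<mu>) < \<epsilon> / (\<bar>c\<bar> + 1)"
    using finite_cut_approx_indicator[OF outer \<C> assms(5) base.hyps] by blast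
  have "(\<integral>x. \<bar>indicator A x *\<^sub>R c - c * indicator F x\<bar> \<partial>\<mu>) = \<bar>c\<bar> * (\<integral>x. \<bar>indicator A x - indicator F x\<bar> \<partial>\<mu>)"
    by (subst integral_mult_right_zero[symmetric], rule Bochner_Integration.integral_cong)
      (auto simp: algebra_simps simp flip: abs_mult)
  also have "\<dots> \<le> \<bar>c\<bar> * (\<epsilon> / (\<bar>c\<bar> + 1))" using F(4) by (intro mult_left_mono) auto
  also have "\<dots> < \<epsilon>" using base.prems by (simp add: field_simps)
  finally show ?case
    using F by (intro exI[of _ "\<lambda>x. c * indicator F x"]) (auto intro!: finite_cut_scale simp: less_top)
next
  case (add f f')
  obtain g g' where g: "integrable \<mu> g" "finite_cut g" "(\<integral>x. \<bar>f x - g x\<bar> \<partial>\<mu>) < \<epsilon> / 2"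
    and g': "integrable \<mu> g'" "finite_cut g'" "(\<integral>x. \<bar>f' x - g' x\<bar> \<partial>\<mu>) < \<epsilon> / 2"
    using add.IH[of "\<epsilon> / 2"] add.prems by auto
  have "(\<integral>x. \<bar>(f x + f' x) - (g x + g' x)\<bar> \<partial>\<mu>) \<le> (\<integral>x. \<bar>f x - g x\<bar> + \<bar>f' x - g' x\<bar> \<partial>\<mu>)"
    using add.hyps g g' by (intro integral_mono) auto
  also have "\<dots> = (\<integral>x. \<bar>f x - g x\<bar> \<partial>\<mu>) + (\<integral>x. \<bar>f' x - g' x\<bar> \<partial>\<mu>)"
    using add.hyps g g' by (intro Bochner_Integration.integral_add) auto
  also have "\<dots> < \<epsilon>" using g g' by simp
  finally show ?case
    using g g' by (intro exI[of _ "\<lambda>x. g x + g' x"]) (auto intro!: finite_cut_add)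
next
  case (lim f s)
  have "(\<lambda>i. \<integral>x. \<bar>f x - s i x\<bar> \<partial>\<mu>) \<longlonglongrightarrow> (\<integral>x. 0 \<partial>\<mu>)"
  \<comment> \<open>The induction rule supplies |s i| \<le> 2 |f|, hence |f - s i| \<le> 3
    |f|.\<close>
  proof (rule integral_dominated_convergence[where w = "\<lambda>x. 3 * norm (f x)"])
    show "AE x in \<mu>. (\<lambda>i. \<bar>f x - s i x\<bar>) \<longlonglongrightarrow> 0"
    proof (rule AE_I2)
      fix x assume "x \<in> space \<mu>"
      then have "(\<lambda>i. \<bar>f x - s i x\<bar>) \<longlonglongrightarrow> \<bar>f x - f x\<bar>"
        using lim.hyps by (intro tendsto_intros) auto
      then show "(\<lambda>i. \<bar>f x - s i x\<bar>) \<longlonglongrightarrow> 0" by simp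
    qed
    show "AE x in \<mu>. norm \<bar>f x - s i x\<bar> \<le> 3 * norm (f x)" for i
    proof (rule AE_I2)
      fix x assume "x \<in> space \<mu>"
      then have "norm (s i x) \<le> 2 * norm (f x)" using lim.hyps by auto
      then show "norm \<bar>f x - s i x\<bar> \<le> 3 * norm (f x)" by simp
    qed
  qed (use lim.hyps in auto)
  then obtain i where "dist (\<integral>x. \<bar>f x - s i x\<bar> \<partial>\<mu>) 0 < \<epsilon> / 2"
    using lim.prems unfolding lim_sequentially by (metis half_gt_zero integral_zero order_refl)
  then have i: "(\<integral>x. \<bar>f x - s i x\<bar> \<partial>\<mu>) < \<epsilon> / 2" by simp
  obtain g where g: "integrable \<mu> g" "finite_cut g" "(\<integral>x. \<bar>s i x - g x\<bar> \<partial>\<mu>) < \<epsilon> / 2"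
    using lim.IH[of "\<epsilon> / 2" i] lim.prems by auto
  have "(\<integral>x. \<bar>f x - g x\<bar> \<partial>\<mu>) \<le> (\<integral>x. \<bar>f x - s i x\<bar> + \<bar>s i x - g x\<bar> \<partial>\<mu>)"
    using lim.hyps g by (intro integral_mono) auto
  also have "\<dots> = (\<integral>x. \<bar>f x - s i x\<bar> \<partial>\<mu>) + (\<integral>x. \<bar>s i x - g x\<bar> \<partial>\<mu>)"
    using lim.hyps g by (intro Bochner_Integration.integral_add) auto
  also have "\<dots> < \<epsilon>" using i g by simp
  finally show ?case using g by blast
qed

end

section \<open>Besov functions above the critical exponent\<close>

text \<open>The value is 0 when \<open>A\<close> has measure zero or infinite measure, because
  \<open>measure\<close> is then 0. Below, \<open>0 < measure \<mu> A\<close> is assumed, which also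
  makes \<open>A\<close> of finite mass.\<close>

definition set_average :: "'a measure \<Rightarrow> 'a set \<Rightarrow> ('a \<Rightarrow> real) \<Rightarrow> real" where
  "set_average \<mu> A f = (\<integral>x. indicator A x * f x \<partial>\<mu>) / measure \<mu> A"

lemma set_average_deviation:
  assumes f: "integrable \<mu> f" and A: "A \<in> sets \<mu>" "0 < measure \<mu> A"
  shows "ennreal (measure \<mu> A) * ennreal \<bar>c - set_average \<mu> A f\<bar>
    \<le> (\<integral>\<^sup>+x. indicator A x * ennreal \<bar>c - f x\<bar> \<partial>\<mu>)"
proof -
  have fin: "emeasure \<mu> A < \<infinity>"
    using A(2) by (metis emeasure_eq_ennreal_measure ennreal_less_top infinity_ennreal_def less_top measure_zero_top less_irrefl)
  have i1: "integrable \<mu> (\<lambda>x. indicator A x * f x)"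
    using integrable_mult_indicator[OF A(1) f] by simp
  have i2: "integrable \<mu> (\<lambda>x. indicator A x * c)"
    using A fin by (simp add: less_top)
  have "measure \<mu> A * (c - set_average \<mu> A f) = (\<integral>x. indicator A x * c \<partial>\<mu>) - (\<integral>x. indicator A x * f x \<partial>\<mu>)"
    using A by (simp add: set_average_def field_simps Int_absorb2 sets.sets_into_space)
  also have "\<dots> = (\<integral>x. indicator A x * (c - f x) \<partial>\<mu>)"
    using i1 i2 by (simp add: algebra_simps)
  finally have eq: "measure \<mu> A * (c - set_average \<mu> A f) = (\<integral>x. indicator A x * (c - f x) \<partial>\<mu>)" .
  have i3: "integrable \<mu> (\<lambda>x. indicator A x * (c - f x))"
    using i1 i2 by (simp add: algebra_simps)
  have "measure \<mu> A * \<bar>c - set_average \<mu> A f\<bar> = \<bar>\<integral>x. indicator A x * (c - f x) \<partial>\<mu>\<bar>"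
    using A(2) by (simp add: abs_mult flip: eq)
  also have "\<dots> \<le> (\<integral>x. \<bar>indicator A x * (c - f x)\<bar> \<partial>\<mu>)"
    by (rule integral_abs_bound)
  finally have "ennreal (measure \<mu> A * \<bar>c - set_average \<mu> A f\<bar>) \<le> ennreal (\<integral>x. \<bar>indicator A x * (c - f x)\<bar> \<partial>\<mu>)"
    by (rule ennreal_leI)
  also have "\<dots> = (\<integral>\<^sup>+x. ennreal \<bar>indicator A x * (c - f x)\<bar> \<partial>\<mu>)"
    by (rule nn_integral_eq_integral[symmetric]) (use i3 in auto)
  also have "\<dots> = (\<integral>\<^sup>+x. indicator A x * ennreal \<bar>c - f x\<bar> \<partial>\<mu>)"
    by (intro nn_integral_cong) (auto simp: indicator_def)
  finally show ?thesis by (simp add: ennreal_mult)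
qed

text \<open>The deviation bound is used twice: on \<open>A\<close> against the constant average over
  \<open>B\<close>, then on \<open>B\<close> against the constant \<open>f x\<close> for each
  \<open>x\<close>.\<close>

lemma set_average_difference:
  assumes f: "integrable \<mu> f" and A: "A \<in> sets \<mu>" "0 < measure \<mu> A" and B: "B \<in> sets \<mu>" "0 < measure \<mu> B"
    and "sigma_finite_measure \<mu>"
  shows "ennreal (measure \<mu> A * measure \<mu> B) * ennreal \<bar>set_average \<mu> A f - set_average \<mu> B f\<bar>
    \<le> (\<integral>\<^sup>+x. indicator A x * (\<integral>\<^sup>+y. indicator B y * ennreal \<bar>f x - f y\<bar> \<partial>\<mu>) \<partial>\<mu>)"
proof -
  interpret sigma_finite_measure \<mu> by fact
  have [measurable]: "f \<in> borel_measurable \<mu>" "A \<in> sets \<mu>" "B \<in> sets \<mu>" using f A B by auto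
  have "ennreal (measure \<mu> A * measure \<mu> B) * ennreal \<bar>set_average \<mu> A f - set_average \<mu> B f\<bar>
     = ennreal (measure \<mu> B) * (ennreal (measure \<mu> A) * ennreal \<bar>set_average \<mu> B f - set_average \<mu> A f\<bar>)"
    by (simp add: ennreal_mult mult_ac abs_minus_commute)
  also have "\<dots> \<le> ennreal (measure \<mu> B) * (\<integral>\<^sup>+x. indicator A x * ennreal \<bar>set_average \<mu> B f - f x\<bar> \<partial>\<mu>)"
    by (intro mult_left_mono set_average_deviation f A) simp
  also have "\<dots> = (\<integral>\<^sup>+x. indicator A x * (ennreal (measure \<mu> B) * ennreal \<bar>f x - set_average \<mu> B f\<bar>) \<partial>\<mu>)"
    by (simp add: nn_integral_cmult[symmetric] mult_ac abs_minus_commute)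
  also have "\<dots> \<le> (\<integral>\<^sup>+x. indicator A x * (\<integral>\<^sup>+y. indicator B y * ennreal \<bar>f x - f y\<bar> \<partial>\<mu>) \<partial>\<mu>)"
    by (intro nn_integral_mono mult_left_mono set_average_deviation f B) simp
  finally show ?thesis .
qed

section \<open>Oscillation at a fixed scale and chains of balls\<close>

context ahlfors_space
begin

text \<open>In a separable space the set is a countable union of products of balls, with centres in
  a dense set and rational first radii, and so belongs to the product sigma-algebra.\<close>

lemma measurable_dist_pair:
  assumes "separable_space mtopology"
  shows "{z \<in> space (\<mu> \<Otimes>\<^sub>M \<mu>). d (fst z) (snd z) < r} \<in> sets (\<mu> \<Otimes>\<^sub>M \<mu>)"
proof -
  obtain D where D: "countable D" "D \<subseteq> X" "mtopology closure_of D = X"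
    using assms unfolding separable_space_def by auto
  have "{z \<in> space (\<mu> \<Otimes>\<^sub>M \<mu>). d (fst z) (snd z) < r}
    = (\<Union>q\<in>D. \<Union>s\<in>\<rat>. mball q s \<times> mball q (r - s))" (is "?L = ?R")
  proof (intro set_eqI iffI)
    fix z assume "z \<in> ?L"
    then obtain x y where z: "z = (x, y)" "x \<in> X" "y \<in> X" "d x y < r"
      by (cases z) (auto simp: space_pair_measure space_eq)
    \<comment> \<open>Half the slack: one half pays for moving from \<open>x\<close> to
      \<open>q\<close>, the other for the radius \<open>s\<close> taken away from
      \<open>r\<close>.\<close>
    define \<epsilon> where "\<epsilon> = (r - d x y) / 2"
    have "0 < \<epsilon>" using z by (simp add: \<epsilon>_def)
    then obtain q where q: "q \<in> D" "q \<in> mball x \<epsilon>"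
      using D(3) z(2) unfolding metric_closure_of by blast
    obtain s where s: "s \<in> \<rat>" "d x q < s" "s < \<epsilon>"
      using Rats_dense_in_real[of "d x q" \<epsilon>] q by auto
    have "d q y \<le> d q x + d x y" using triangle q z by simp
    then have "z \<in> mball q s \<times> mball q (r - s)"
      using z q s by (auto simp: \<epsilon>_def commute field_simps)
    then show "z \<in> ?R" using q s by blast
  next
    fix z assume "z \<in> ?R"
    then obtain q s where "z \<in> mball q s \<times> mball q (r - s)" by blast
    then obtain x y where z: "z = (x, y)" "x \<in> mball q s" "y \<in> mball q (r - s)" by blast
    then have "d x y \<le> d x q + d q y" using triangle by auto
    then show "z \<in> ?L" using z by (auto simp: space_pair_measure space_eq commute)
  qed
  also have "\<dots> \<in> sets (\<mu> \<Otimes>\<^sub>M \<mu>)"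
    using D(1) countable_rat by (intro sets.countable_UN') auto
  finally show ?thesis .
qed

definition local_oscillation :: "('a \<Rightarrow> real) \<Rightarrow> real \<Rightarrow> 'a \<Rightarrow> ennreal" where
  "local_oscillation f r x = (\<integral>\<^sup>+y. indicator (mball x r) y * ennreal \<bar>f x - f y\<bar> \<partial>\<mu>)"

text \<open>The L^1 Korevaar-Schoen functional without its division by ball volumes and a power of
  the radius. Values in \<open>ennreal\<close> allow estimates before finiteness is known.\<close>

definition oscillation :: "('a \<Rightarrow> real) \<Rightarrow> real \<Rightarrow> ennreal" where
  "oscillation f r = (\<integral>\<^sup>+x. local_oscillation f r x \<partial>\<mu>)"

lemma measurable_local_oscillation:
  assumes sep: "separable_space mtopology" and [measurable]: "f \<in> borel_measurable \<mu>"
  shows "local_oscillation f r \<in> borel_measurable \<mu>"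
proof -
  interpret sf: sigma_finite_measure \<mu> by (rule sigma_finite)
  note [measurable] = measurable_dist_pair[OF sep, of r]
  have "(\<lambda>z. indicator {z \<in> space (\<mu> \<Otimes>\<^sub>M \<mu>). d (fst z) (snd z) < r} z * ennreal \<bar>f (fst z) - f (snd z)\<bar>)
      \<in> borel_measurable (\<mu> \<Otimes>\<^sub>M \<mu>)"
    by measurable
  then have "(\<lambda>(x, y). indicator (mball x r) y * ennreal \<bar>f x - f y\<bar>) \<in> borel_measurable (\<mu> \<Otimes>\<^sub>M \<mu>)"
    by (rule measurable_cong[THEN iffD1, rotated]) (auto simp: space_pair_measure space_eq indicator_def)
  then show ?thesis
    unfolding local_oscillation_def by (rule sf.borel_measurable_nn_integral)
qed

text \<open>At time t = r^dW the exponential in the lower kernel bound stays above a constant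
  depending on \<kappa> as long as d x y < \<kappa> r, so the kernel is at least a r^(- dH) there.
  The Besov integral at that time is at most N t^\<alpha> = N r^(\<alpha> dW).\<close>

lemma oscillation_besov1:
  assumes p: "sub_Gaussian_bounds \<mu> d p dH dW" and f: "f \<in> besov1 \<mu> p \<alpha>" and "0 < \<kappa>"
    and sep: "separable_space mtopology"
  obtains C where "0 \<le> C" "\<And>r. 0 < r \<Longrightarrow> oscillation f (\<kappa> * r) \<le> ennreal (C * r powr (dH + \<alpha> * dW))"
proof -
  interpret sf: sigma_finite_measure \<mu> by (rule sigma_finite)
  interpret pf: pair_sigma_finite \<mu> \<mu> by standard
  have [measurable]: "f \<in> borel_measurable \<mu>" using f by (auto simp: besov1_def)
  have dW: "2 < dW" using p by (simp add: sub_Gaussian_bounds_def)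
  obtain c5 c6 where c: "0 < c5" "0 < c6" and lb: "\<And>t. 0 < t \<Longrightarrow> AE (x, y) in \<mu> \<Otimes>\<^sub>M \<mu>.
      c5 * t powr (- dH / dW) * exp (- c6 * ((d x y powr dW) / t) powr (1 / (dW - 1))) \<le> p t x y"
  proof -
    obtain c3 c4 c5 c6 where "0 < c5" "0 < c6" and *: "\<And>t. 0 < t \<Longrightarrow> AE (x, y) in \<mu> \<Otimes>\<^sub>M \<mu>.
        c5 * t powr (- dH / dW) * exp (- c6 * ((d x y powr dW) / t) powr (1 / (dW - 1))) \<le> p t x y \<and>
        p t x y \<le> c3 * t powr (- dH / dW) * exp (- c4 * ((d x y powr dW) / t) powr (1 / (dW - 1)))"
      using p unfolding sub_Gaussian_bounds_def by blast
    show ?thesis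
    proof (rule that[OF \<open>0 < c5\<close> \<open>0 < c6\<close>])
      fix t :: real assume "0 < t"
      show "AE (x, y) in \<mu> \<Otimes>\<^sub>M \<mu>. c5 * t powr (- dH / dW) * exp (- c6 * ((d x y powr dW) / t) powr (1 / (dW - 1))) \<le> p t x y"
        using *[OF \<open>0 < t\<close>] by eventually_elim auto
    qed
  qed
  obtain N where N: "0 \<le> N" "besov_seminorm1 \<mu> p \<alpha> f = ennreal N"
    using f by (auto simp: besov1_def less_top elim: ennreal_cases)
  define a where "a = c5 * exp (- c6 * (\<kappa> powr dW) powr (1 / (dW - 1)))"
  have a: "0 < a" using c by (simp add: a_def)
  show ?thesis
  proof (rule that[of "N / a"])
    show "0 \<le> N / a" using N a by simp
    fix r :: real assume r: "0 < r"
    define t where "t = r powr dW"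
    have t: "0 < t" using r by (simp add: t_def)
    have tr: "t powr (- dH / dW) = r powr (- dH)" "t powr \<alpha> = r powr (\<alpha> * dW)"
      using dW by (simp_all add: t_def powr_powr mult.commute)
    have "ennreal (t powr (- \<alpha>)) * (\<integral>\<^sup>+x. (\<integral>\<^sup>+y. ennreal (\<bar>f x - f y\<bar> * p t x y) \<partial>\<mu>) \<partial>\<mu>) \<le> ennreal N"
      unfolding N(2)[symmetric] besov_seminorm1_def using t by (intro SUP_upper) auto
    then have up: "ennreal (t powr \<alpha>) * (ennreal (t powr (- \<alpha>)) *
        (\<integral>\<^sup>+x. (\<integral>\<^sup>+y. ennreal (\<bar>f x - f y\<bar> * p t x y) \<partial>\<mu>) \<partial>\<mu>)) \<le> ennreal (t powr \<alpha>) * ennreal N"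
      by (rule mult_left_mono) simp
    have "ennreal (t powr \<alpha>) * ennreal (t powr (- \<alpha>)) = 1"
      using t by (simp flip: ennreal_mult powr_add)
    then have up: "(\<integral>\<^sup>+x. (\<integral>\<^sup>+y. ennreal (\<bar>f x - f y\<bar> * p t x y) \<partial>\<mu>) \<partial>\<mu>) \<le> ennreal (t powr \<alpha> * N)"
      using up N(1) by (simp add: ennreal_mult flip: mult.assoc)
    have pt: "ennreal (a * r powr (- dH)) * (indicator (mball x (\<kappa> * r)) y * ennreal \<bar>f x - f y\<bar>)
         \<le> ennreal (\<bar>f x - f y\<bar> * p t x y)"
      if le: "c5 * t powr (- dH / dW) * exp (- c6 * ((d x y powr dW) / t) powr (1 / (dW - 1))) \<le> p t x y" for x y
    proof (cases "y \<in> mball x (\<kappa> * r)")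
      case True
      then have "d x y \<le> \<kappa> * r" by auto
      then have "d x y powr dW \<le> (\<kappa> * r) powr dW" using dW by (intro powr_mono2) auto
      also have "(\<kappa> * r) powr dW = \<kappa> powr dW * t" using r \<open>0 < \<kappa>\<close> by (simp add: t_def powr_mult)
      finally have "d x y powr dW / t \<le> \<kappa> powr dW" using t by (simp add: field_simps)
      then have "(d x y powr dW / t) powr (1 / (dW - 1)) \<le> (\<kappa> powr dW) powr (1 / (dW - 1))"
        using dW t by (intro powr_mono2) auto
      then have "exp (- c6 * (\<kappa> powr dW) powr (1 / (dW - 1))) \<le> exp (- c6 * ((d x y powr dW) / t) powr (1 / (dW - 1)))"
        using c by simp
      then have "c5 * t powr (- dH / dW) * exp (- c6 * (\<kappa> powr dW) powr (1 / (dW - 1)))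
         \<le> c5 * t powr (- dH / dW) * exp (- c6 * ((d x y powr dW) / t) powr (1 / (dW - 1)))"
        using c by (intro mult_left_mono) auto
      then have "a * r powr (- dH) \<le> p t x y"
        using le unfolding a_def tr by (simp add: mult_ac)
      then have "\<bar>f x - f y\<bar> * (a * r powr (- dH)) \<le> \<bar>f x - f y\<bar> * p t x y"
        by (rule mult_left_mono) simp
      then show ?thesis
        using True a by (simp add: ennreal_leI mult_ac flip: ennreal_mult)
    qed simp
    have "AE x in \<mu>. AE y in \<mu>. c5 * t powr (- dH / dW) * exp (- c6 * ((d x y powr dW) / t) powr (1 / (dW - 1))) \<le> p t x y"
      using pf.AE_pair[OF lb[OF t]] by simp
    then have "(\<integral>\<^sup>+x. (\<integral>\<^sup>+y. ennreal (a * r powr (- dH)) * (indicator (mball x (\<kappa> * r)) y * ennreal \<bar>f x - f y\<bar>) \<partial>\<mu>) \<partial>\<mu>)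
      \<le> (\<integral>\<^sup>+x. (\<integral>\<^sup>+y. ennreal (\<bar>f x - f y\<bar> * p t x y) \<partial>\<mu>) \<partial>\<mu>)"
    proof (intro nn_integral_mono_AE, elim AE_mp, intro AE_I2 impI)
      fix x assume x: "AE y in \<mu>. c5 * t powr (- dH / dW) * exp (- c6 * ((d x y powr dW) / t) powr (1 / (dW - 1))) \<le> p t x y"
      show "(\<integral>\<^sup>+y. ennreal (a * r powr (- dH)) * (indicator (mball x (\<kappa> * r)) y * ennreal \<bar>f x - f y\<bar>) \<partial>\<mu>)
        \<le> (\<integral>\<^sup>+y. ennreal (\<bar>f x - f y\<bar> * p t x y) \<partial>\<mu>)"
        using x by (intro nn_integral_mono_AE, elim AE_mp) (intro AE_I2 impI pt)
    qed
    then have "(\<integral>\<^sup>+x. ennreal (a * r powr (- dH)) * local_oscillation f (\<kappa> * r) x \<partial>\<mu>) \<le> ennreal (t powr \<alpha> * N)"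
      using up unfolding local_oscillation_def by (simp add: nn_integral_cmult)
    then have "ennreal (a * r powr (- dH)) * oscillation f (\<kappa> * r) \<le> ennreal (t powr \<alpha> * N)"
      unfolding oscillation_def by (simp add: nn_integral_cmult measurable_local_oscillation[OF sep])
    then have "ennreal (r powr dH / a) * (ennreal (a * r powr (- dH)) * oscillation f (\<kappa> * r))
        \<le> ennreal (r powr dH / a) * ennreal (t powr \<alpha> * N)"
      by (rule mult_left_mono) simp
    moreover have "ennreal (r powr dH / a) * ennreal (a * r powr (- dH)) = 1"
    proof -
      have "r powr dH / a * (a * r powr (- dH)) = 1"
        using a r by (simp flip: powr_add)
      moreover have "0 \<le> a * r powr (- dH)" using a by simp
      ultimately show ?thesis by (metis ennreal_mult'' ennreal_1)
    qed
    moreover have "ennreal (r powr dH / a) * ennreal (t powr \<alpha> * N) = ennreal (N / a * r powr (dH + \<alpha> * dW))"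
      using a N(1) by (simp add: tr powr_add mult_ac flip: ennreal_mult)
    ultimately show "oscillation f (\<kappa> * r) \<le> ennreal (N / a * r powr (dH + \<alpha> * dW))"
      by (simp flip: mult.assoc)
  qed
qed

text \<open>Points spaced evenly on a geodesic carry balls that are far enough apart to be disjoint
  and close enough that neighbours see each other at scale 3 r. The bound thus does not depend on
  the distance from \<open>x\<close> to \<open>y\<close>.\<close>

lemma average_chain_bound:
  assumes geo: "geodesic_space X d" and sep: "separable_space mtopology" and f: "integrable \<mu> f"
    and r: "0 < r" and m: "0 < m" "\<And>x. x \<in> X \<Longrightarrow> m \<le> measure \<mu> (mball x (r / 2))"
    and x: "x \<in> X" and y: "y \<in> X"
  shows "ennreal (m * m) * ennreal \<bar>set_average \<mu> (mball x (r / 2)) f - set_average \<mu> (mball y (r / 2)) f\<bar>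
    \<le> oscillation f (3 * r)"
proof -
  interpret sf: sigma_finite_measure \<mu> by (rule sigma_finite)
  have [measurable]: "f \<in> borel_measurable \<mu>" using f by auto
  note [measurable] = measurable_local_oscillation[OF sep \<open>f \<in> borel_measurable \<mu>\<close>]
  define D where "D = d x y"
  have D0: "0 \<le> D" by (simp add: D_def)
  obtain \<gamma> where \<gamma>: "\<gamma> ` {0..D} \<subseteq> X" "\<gamma> 0 = x" "\<gamma> D = y"
    "\<And>s t. s \<in> {0..D} \<Longrightarrow> t \<in> {0..D} \<Longrightarrow> d (\<gamma> s) (\<gamma> t) = \<bar>s - t\<bar>"
    using geo x y unfolding geodesic_space_def D_def by meson
  \<comment> \<open>The spacing \<open>s\<close> is then at most 2 r, and at least \<open>r\<close>
    once there are two links; the maximum covers endpoints closer than \<open>r\<close>.\<close>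
  define n where "n = max 1 (nat \<lfloor>D / r\<rfloor>)"
  define s where "s = D / real n"
  have n1: "1 \<le> n" by (simp add: n_def)
  have s0: "0 \<le> s" using D0 by (simp add: s_def)
  have fl: "real (nat \<lfloor>D / r\<rfloor>) \<le> D / r" "D / r < real (nat \<lfloor>D / r\<rfloor>) + 1"
    using r D0 by simp_all
  have "D / r \<le> 2 * real n"
    using fl(2) n1 unfolding n_def by linarith
  then have s2: "s \<le> 2 * r"
    using n1 r by (simp add: s_def field_simps)
  have sr: "r \<le> s" if "2 \<le> n"
  proof -
    have "real n \<le> D / r" using that fl(1) unfolding n_def by (auto simp: max_def split: if_splits)
    then show ?thesis using that r by (simp add: s_def field_simps)
  qed
  define z where "z i = \<gamma> (real i * s)" for i
  have dom: "real i * s \<in> {0..D}" if "i \<le> n" for i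
  proof -
    have "real i * s \<le> real n * s" using that s0 by (intro mult_right_mono) auto
    moreover have "real n * s = D" using n1 by (simp add: s_def)
    moreover have "0 \<le> real i * s" using s0 by simp
    ultimately show ?thesis by simp
  qed
  have zX: "z i \<in> X" if "i \<le> n" for i using dom[OF that] \<gamma>(1) by (auto simp: z_def)
  have zd: "d (z i) (z j) = \<bar>real i - real j\<bar> * s" if "i \<le> n" "j \<le> n" for i j
    using \<gamma>(4)[OF dom[OF that(1)] dom[OF that(2)]] s0
    by (simp add: z_def abs_mult flip: left_diff_distrib)
  have ends: "z 0 = x" "z n = y" using \<gamma> n1 by (simp_all add: z_def s_def)
  define A where "A i = mball (z i) (r / 2)" for i
  have [measurable]: "A i \<in> sets \<mu>" for i by (simp add: A_def)
  \<comment> \<open>Only the balls 0 to n - 1 carry outer integrals. The last one may overlap its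
    neighbour when n = 1, since the endpoints can then be arbitrarily close.\<close>
  have disj: "disjoint_family_on A {..<n}"
    unfolding disjoint_family_on_def
  proof (intro ballI impI)
    fix i j assume ij: "i \<in> {..<n}" "j \<in> {..<n}" "i \<noteq> j"
    then have "2 \<le> n" by auto
    then have "r \<le> s" by (rule sr)
    also have "s \<le> \<bar>real i - real j\<bar> * s"
    proof -
      have "1 \<le> \<bar>real i - real j\<bar>" using ij(3) by linarith
      then show ?thesis using mult_right_mono[OF _ s0] by fastforce
    qed
    also have "\<dots> = d (z i) (z j)" using ij by (simp add: zd)
    finally have far: "r \<le> d (z i) (z j)" .
    show "A i \<inter> A j = {}"
    proof (rule ccontr)
      assume "A i \<inter> A j \<noteq> {}"
      then obtain u where u: "u \<in> mball (z i) (r / 2)" "u \<in> mball (z j) (r / 2)" unfolding A_def by blast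
      have "d (z i) (z j) \<le> d (z i) u + d u (z j)" using u by (intro triangle) auto
      also have "\<dots> < r" using u by (auto simp: commute)
      finally show False using far by simp
    qed
  qed
  define v where "v i = set_average \<mu> (A i) f" for i
  have step: "ennreal (m * m) * ennreal \<bar>v i - v (Suc i)\<bar> \<le> (\<integral>\<^sup>+u. indicator (A i) u * local_oscillation f (3 * r) u \<partial>\<mu>)"
    if i: "i < n" for i
  proof -
    have mi: "m \<le> measure \<mu> (A i)" "m \<le> measure \<mu> (A (Suc i))" using i m(2) zX by (auto simp: A_def)
    have near: "w \<in> mball u (3 * r)" if u: "u \<in> A i" and w: "w \<in> A (Suc i)" for u w
    proof -
      have X: "u \<in> X" "w \<in> X" "z i \<in> X" "z (Suc i) \<in> X" using u w zX i by (auto simp: A_def)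
      have "d u w \<le> d u (z i) + d (z i) w" using X by (intro triangle)
      also have "d (z i) w \<le> d (z i) (z (Suc i)) + d (z (Suc i)) w" using X by (intro triangle)
      also have "d (z i) (z (Suc i)) = s" using i by (simp add: zd)
      \<comment> \<open>Two radii r / 2 and one spacing of at most 2 r.\<close>
      finally have "d u w < 3 * r" using u w s2 by (auto simp: A_def commute)
      then show ?thesis using X by simp
    qed
    have "ennreal (m * m) * ennreal \<bar>v i - v (Suc i)\<bar>
       \<le> ennreal (measure \<mu> (A i) * measure \<mu> (A (Suc i))) * ennreal \<bar>v i - v (Suc i)\<bar>"
      using mi m(1) by (intro mult_right_mono ennreal_leI mult_mono) auto
    also have "\<dots> \<le> (\<integral>\<^sup>+u. indicator (A i) u * (\<integral>\<^sup>+w. indicator (A (Suc i)) w * ennreal \<bar>f u - f w\<bar> \<partial>\<mu>) \<partial>\<mu>)"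
      unfolding v_def using mi m(1) by (intro set_average_difference f sigma_finite) auto
    also have "\<dots> \<le> (\<integral>\<^sup>+u. indicator (A i) u * local_oscillation f (3 * r) u \<partial>\<mu>)"
      unfolding local_oscillation_def
    proof (intro nn_integral_mono)
      fix u
      show "indicator (A i) u * (\<integral>\<^sup>+w. indicator (A (Suc i)) w * ennreal \<bar>f u - f w\<bar> \<partial>\<mu>)
        \<le> indicator (A i) u * (\<integral>\<^sup>+w. indicator (mball u (3 * r)) w * ennreal \<bar>f u - f w\<bar> \<partial>\<mu>)"
      proof (cases "u \<in> A i")
        case True
        then show ?thesis
          using near by (intro mult_left_mono nn_integral_mono mult_right_mono) (auto simp: indicator_def)
      qed simp
    qed
    finally show ?thesis .
  qed
  have "\<bar>v 0 - v n\<bar> = \<bar>\<Sum>i<n. v i - v (Suc i)\<bar>"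
    by (simp add: sum_lessThan_telescope')
  also have "\<dots> \<le> (\<Sum>i<n. \<bar>v i - v (Suc i)\<bar>)" by (rule sum_abs)
  finally have "ennreal (m * m) * ennreal \<bar>v 0 - v n\<bar> \<le> ennreal (m * m) * (\<Sum>i<n. ennreal \<bar>v i - v (Suc i)\<bar>)"
    by (intro mult_left_mono) (auto simp: sum_ennreal intro: ennreal_leI)
  also have "\<dots> \<le> (\<Sum>i<n. \<integral>\<^sup>+u. indicator (A i) u * local_oscillation f (3 * r) u \<partial>\<mu>)"
    unfolding sum_distrib_left by (intro sum_mono step) simp
  also have "\<dots> = (\<integral>\<^sup>+u. (\<Sum>i<n. indicator (A i) u * local_oscillation f (3 * r) u) \<partial>\<mu>)"
    by (rule nn_integral_sum[symmetric]) simp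
  also have "\<dots> \<le> (\<integral>\<^sup>+u. local_oscillation f (3 * r) u \<partial>\<mu>)"
  proof (rule nn_integral_mono)
    fix u
    \<comment> \<open>Here disjointness pays off: each point is counted at most once, whatever the
      number of links.\<close>
    have "(\<Sum>i<n. indicator (A i) u * local_oscillation f (3 * r) u)
      = indicator (\<Union>i\<in>{..<n}. A i) u * local_oscillation f (3 * r) u"
      by (simp add: indicator_UN_disjoint[OF _ disj] flip: sum_distrib_right)
    also have "\<dots> \<le> local_oscillation f (3 * r) u" by (simp add: indicator_def)
    finally show "(\<Sum>i<n. indicator (A i) u * local_oscillation f (3 * r) u) \<le> local_oscillation f (3 * r) u" .
  qed
  finally show ?thesis
    by (simp add: v_def A_def ends oscillation_def)
qed

lemma ennreal_le_divide_of_mult_le: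
  assumes "ennreal m * a \<le> b" "0 < m"
  shows "a \<le> ennreal (1 / m) * b"
proof -
  have "ennreal (1 / m) * (ennreal m * a) \<le> ennreal (1 / m) * b"
    by (rule mult_left_mono[OF assms(1)]) simp
  moreover have "ennreal (1 / m) * ennreal m = 1"
    using assms(2) by (simp flip: ennreal_mult)
  ultimately show ?thesis by (simp flip: mult.assoc)
qed

text \<open>Pass from \<open>f x\<close> to \<open>f y\<close> through the averages over the balls
  around \<open>x\<close> and \<open>y\<close>. The bound holds at every pair of points; the two
  local terms become small only after integration.\<close>

lemma difference_le_oscillation:
  assumes geo: "geodesic_space X d" and sep: "separable_space mtopology" and f: "integrable \<mu> f"
    and r: "0 < r" and m: "0 < m" "\<And>x. x \<in> X \<Longrightarrow> m \<le> measure \<mu> (mball x (r / 2))"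
    and x: "x \<in> X" and y: "y \<in> X"
  shows "ennreal \<bar>f x - f y\<bar> \<le> ennreal (1 / m) * (local_oscillation f (3 * r) x + local_oscillation f (3 * r) y)
    + ennreal (1 / (m * m)) * oscillation f (3 * r)"
proof -
  let ?a = "\<lambda>x. set_average \<mu> (mball x (r / 2)) f"
  have dev: "ennreal \<bar>f x - ?a x\<bar> \<le> ennreal (1 / m) * local_oscillation f (3 * r) x" if x: "x \<in> X" for x
  proof (rule ennreal_le_divide_of_mult_le[OF _ m(1)])
    have "ennreal m * ennreal \<bar>f x - ?a x\<bar> \<le> ennreal (measure \<mu> (mball x (r / 2))) * ennreal \<bar>f x - ?a x\<bar>"
      using m(2)[OF x] by (intro mult_right_mono ennreal_leI) auto
    also have "\<dots> \<le> (\<integral>\<^sup>+y. indicator (mball x (r / 2)) y * ennreal \<bar>f x - f y\<bar> \<partial>\<mu>)"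
      using m(1) m(2)[OF x] by (intro set_average_deviation f) auto
    also have "\<dots> \<le> local_oscillation f (3 * r) x"
      unfolding local_oscillation_def using r by (intro nn_integral_mono mult_right_mono) (auto simp: indicator_def)
    finally show "ennreal m * ennreal \<bar>f x - ?a x\<bar> \<le> local_oscillation f (3 * r) x" .
  qed
  have chain: "ennreal \<bar>?a x - ?a y\<bar> \<le> ennreal (1 / (m * m)) * oscillation f (3 * r)"
    using m(1) by (intro ennreal_le_divide_of_mult_le average_chain_bound[OF geo sep f r m x y]) auto
  have "\<bar>f x - f y\<bar> \<le> \<bar>f x - ?a x\<bar> + \<bar>f y - ?a y\<bar> + \<bar>?a x - ?a y\<bar>" by linarith
  then have "ennreal \<bar>f x - f y\<bar> \<le> ennreal \<bar>f x - ?a x\<bar> + ennreal \<bar>f y - ?a y\<bar> + ennreal \<bar>?a x - ?a y\<bar>"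
    by (simp add: ennreal_leI flip: ennreal_plus)
  also have "\<dots> \<le> ennreal (1 / m) * local_oscillation f (3 * r) x + ennreal (1 / m) * local_oscillation f (3 * r) y
     + ennreal (1 / (m * m)) * oscillation f (3 * r)"
    by (intro add_mono dev chain x y)
  finally show ?thesis by (simp add: distrib_left)
qed

text \<open>Integrating the pointwise bound over the square of the ball leaves local terms of order
  E/m and a chain term of order E/m^2, where m is of order r^dH and E of order r^(dH + \<alpha> dW).
  Their powers r^(\<alpha> dW) and r^(\<alpha> dW - dH) both tend to 0 with r.\<close>

lemma besov1_constant_on_balls:
  assumes geo: "geodesic_space X d" and sep: "separable_space mtopology"
    and p: "sub_Gaussian_bounds \<mu> d p dH dW" and f: "f \<in> besov1 \<mu> p \<alpha>" and \<alpha>: "dH / dW < \<alpha>"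
  shows "(\<integral>\<^sup>+x. (\<integral>\<^sup>+y. indicator (mball a R) x * (indicator (mball a R) y * ennreal \<bar>f x - f y\<bar>) \<partial>\<mu>) \<partial>\<mu>) = 0"
    (is "?I = 0")
proof -
  interpret sf: sigma_finite_measure \<mu> by (rule sigma_finite)
  have fi: "integrable \<mu> f" using f by (simp add: besov1_def)
  have fm [measurable]: "f \<in> borel_measurable \<mu>" using fi by auto
  note [measurable] = measurable_local_oscillation[OF sep fm]
  have dW: "2 < dW" using p by (simp add: sub_Gaussian_bounds_def)
  obtain C where C: "0 \<le> C" "\<And>r. 0 < r \<Longrightarrow> oscillation f (3 * r) \<le> ennreal (C * r powr (dH + \<alpha> * dW))"
    using oscillation_besov1[OF p f _ sep, of 3] by auto
  obtain c1 where c1: "0 < c1" "\<And>x r. x \<in> X \<Longrightarrow> 0 \<le> r \<Longrightarrow> ennreal (c1 * r powr dH) \<le> emeasure \<mu> (mball x r)"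
    using ball_bounds by metis
  \<comment> \<open>The averages live on balls of radius r / 2, hence the factor (1 / 2)^dH.\<close>
  define c where "c = c1 * (1 / 2) powr dH"
  have c: "0 < c" using c1 by (simp add: c_def)
  define B where "B = mball a R"
  have [measurable]: "B \<in> sets \<mu>" by (simp add: B_def)
  define b where "b = measure \<mu> B"
  have eb: "emeasure \<mu> B = ennreal b"
    using emeasure_mball_finite[of a R] unfolding B_def b_def by (simp add: emeasure_eq_ennreal_measure less_top)
  have b0: "0 \<le> b" by (simp add: b_def)
  define G where "G r = 2 * b * C / c * r powr (\<alpha> * dW) + b * b * C / (c * c) * r powr (\<alpha> * dW - dH)" for r
  have bound: "?I \<le> ennreal (G r)" if r: "0 < r" for r
  proof -
    define m where "m = c * r powr dH"
    have m0: "0 < m" using c r by (simp add: m_def)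
    have m: "m \<le> measure \<mu> (mball x (r / 2))" if "x \<in> X" for x
    proof -
      have "m = c1 * (r / 2) powr dH" using r by (simp add: m_def c_def powr_mult[symmetric] powr_divide)
      then have "ennreal m \<le> ennreal (measure \<mu> (mball x (r / 2)))"
        using c1(2)[OF that, of "r / 2"] r emeasure_mball_finite[of x "r / 2"]
        by (simp add: emeasure_eq_ennreal_measure less_top)
      then show ?thesis by simp
    qed
    let ?l = "local_oscillation f (3 * r)" and ?E = "oscillation f (3 * r)"
    have lE: "(\<integral>\<^sup>+x. indicator B x * ?l x \<partial>\<mu>) \<le> ?E"
      unfolding oscillation_def by (intro nn_integral_mono) (auto simp: indicator_def)
    have inner: "(\<integral>\<^sup>+y. indicator B x * (indicator B y * ennreal \<bar>f x - f y\<bar>) \<partial>\<mu>)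
      \<le> indicator B x * (ennreal (1 / m) * (ennreal b * ?l x + ?E) + ennreal b * (ennreal (1 / (m * m)) * ?E))"
      for x
    proof (cases "x \<in> B")
      case True
      then have x: "x \<in> X" by (auto simp: B_def)
      have "(\<integral>\<^sup>+y. indicator B y * ennreal \<bar>f x - f y\<bar> \<partial>\<mu>)
        \<le> (\<integral>\<^sup>+y. ennreal (1 / m) * (?l x * indicator B y) + ennreal (1 / m) * (indicator B y * ?l y) + (ennreal (1 / (m * m)) * ?E) * indicator B y \<partial>\<mu>)"
      proof (rule nn_integral_mono)
        fix y assume "y \<in> space \<mu>"
        then show "indicator B y * ennreal \<bar>f x - f y\<bar>
          \<le> ennreal (1 / m) * (?l x * indicator B y) + ennreal (1 / m) * (indicator B y * ?l y) + (ennreal (1 / (m * m)) * ?E) * indicator B y"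
          using difference_le_oscillation[OF geo sep fi r m0 m x, of y]
          by (auto simp: indicator_def space_eq distrib_left)
      qed
      also have "\<dots> = ennreal (1 / m) * (?l x * ennreal b) + ennreal (1 / m) * (\<integral>\<^sup>+y. indicator B y * ?l y \<partial>\<mu>)
          + (ennreal (1 / (m * m)) * ?E) * ennreal b"
        by (simp add: nn_integral_add nn_integral_cmult eb)
      also have "\<dots> \<le> ennreal (1 / m) * (?l x * ennreal b) + ennreal (1 / m) * ?E + (ennreal (1 / (m * m)) * ?E) * ennreal b"
        by (intro add_mono mult_left_mono lE) auto
      finally show ?thesis using True by (simp add: distrib_left mult_ac)
    qed simp
    have "?I \<le> (\<integral>\<^sup>+x. ennreal (1 / m) * (ennreal b * (indicator B x * ?l x)) + (ennreal (1 / m) * ?E) * indicator B x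
        + (ennreal b * (ennreal (1 / (m * m)) * ?E)) * indicator B x \<partial>\<mu>)"
      unfolding B_def[symmetric]
      by (intro nn_integral_mono order_trans[OF inner]) (simp add: distrib_left mult_ac)
    also have "\<dots> = ennreal (1 / m) * (ennreal b * (\<integral>\<^sup>+x. indicator B x * ?l x \<partial>\<mu>)) + (ennreal (1 / m) * ?E) * ennreal b
        + (ennreal b * (ennreal (1 / (m * m)) * ?E)) * ennreal b"
      by (simp add: nn_integral_add nn_integral_cmult eb)
    also have "\<dots> \<le> ennreal (1 / m) * (ennreal b * ?E) + (ennreal (1 / m) * ?E) * ennreal b
        + (ennreal b * (ennreal (1 / (m * m)) * ?E)) * ennreal b"
      by (intro add_mono mult_left_mono lE) auto
    also have "\<dots> \<le> ennreal (1 / m) * (ennreal b * ennreal (C * r powr (dH + \<alpha> * dW))) + (ennreal (1 / m) * ennreal (C * r powr (dH + \<alpha> * dW))) * ennreal b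
        + (ennreal b * (ennreal (1 / (m * m)) * ennreal (C * r powr (dH + \<alpha> * dW)))) * ennreal b"
      by (intro add_mono mult_left_mono mult_right_mono C r) auto
    also have "\<dots> = ennreal (1 / m * (b * (C * r powr (dH + \<alpha> * dW))) + 1 / m * (C * r powr (dH + \<alpha> * dW)) * b
        + b * (1 / (m * m) * (C * r powr (dH + \<alpha> * dW))) * b)"
      using m0 b0 C(1) by (simp add: less_imp_le flip: ennreal_mult ennreal_plus)
    also have "1 / m * (b * (C * r powr (dH + \<alpha> * dW))) + 1 / m * (C * r powr (dH + \<alpha> * dW)) * b
        + b * (1 / (m * m) * (C * r powr (dH + \<alpha> * dW))) * b = G r"
      using c r by (simp add: G_def m_def powr_add powr_diff field_simps)
    finally show ?thesis .
  qed
  have "((\<lambda>r. ennreal (G r)) \<longlongrightarrow> ennreal 0) (at_right 0)"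
  proof (rule tendsto_ennrealI)
    have e: "0 < \<alpha> * dW" "0 < \<alpha> * dW - dH"
    proof -
      show "0 < \<alpha> * dW - dH" using \<alpha> dW by (simp add: field_simps)
      then show "0 < \<alpha> * dW" using dH_pos by simp
    qed
    show "(G \<longlongrightarrow> 0) (at_right 0)"
    proof -
      have pw: "((\<lambda>r::real. r powr q) \<longlongrightarrow> 0) (at_right 0)" if "0 < q" for q
        using that by real_asymp
      show ?thesis
        unfolding G_def by (intro tendsto_add_zero tendsto_mult_right_zero pw e)
    qed
  qed
  \<comment> \<open>The double integral does not involve \<open>r\<close>, so the bound passes to
    the limit.\<close>
  then have "?I \<le> ennreal 0"
    by (rule tendsto_lowerbound) (auto simp: eventually_at_right_less intro!: eventually_mono[OF eventually_at_right_less] bound)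
  then show ?thesis by simp
qed

text \<open>Vanishing of all double integrals over balls of integer radius yields one point
  \<open>x\<close> that is good for every radius; then \<open>f\<close> equals the constant
  \<open>f x\<close> almost everywhere. An integrable constant on a space of infinite mass is
  0.\<close>

lemma besov1_AE_zero:
  assumes geo: "geodesic_space X d" and sep: "separable_space mtopology"
    and p: "sub_Gaussian_bounds \<mu> d p dH dW" and f: "f \<in> besov1 \<mu> p \<alpha>" and \<alpha>: "dH / dW < \<alpha>"
    and "X \<noteq> {}"
  shows "AE x in \<mu>. f x = 0"
proof -
  interpret sf: sigma_finite_measure \<mu> by (rule sigma_finite)
  have fi: "integrable \<mu> f" using f by (simp add: besov1_def)
  have fm [measurable]: "f \<in> borel_measurable \<mu>" using fi by auto
  obtain a where a: "a \<in> X" using \<open>X \<noteq> {}\<close> by blast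
  have inf: "emeasure \<mu> (space \<mu>) = \<infinity>"
    using emeasure_space_infinite[OF \<open>X \<noteq> {}\<close>] by (simp add: space_eq)
  have "AE x in \<mu>. (\<integral>\<^sup>+y. indicator (mball a (real n)) x * (indicator (mball a (real n)) y * ennreal \<bar>f x - f y\<bar>) \<partial>\<mu>) = 0" for n :: nat
    using besov1_constant_on_balls[OF geo sep p f \<alpha>, of a "real n"]
    by (subst (asm) nn_integral_0_iff_AE) auto
  then have "AE x in \<mu>. \<forall>n::nat. (\<integral>\<^sup>+y. indicator (mball a (real n)) x * (indicator (mball a (real n)) y * ennreal \<bar>f x - f y\<bar>) \<partial>\<mu>) = 0"
    by (simp add: AE_all_countable)
  then have "AE x in \<mu>. x \<in> space \<mu> \<and>
    (\<forall>n::nat. (\<integral>\<^sup>+y. indicator (mball a (real n)) x * (indicator (mball a (real n)) y * ennreal \<bar>f x - f y\<bar>) \<partial>\<mu>) = 0)"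
    using AE_space by eventually_elim blast
  \<comment> \<open>A property holding almost everywhere has a witness because the space is not
    null.\<close>
  moreover have "ae_filter \<mu> \<noteq> bot" using inf by (simp add: ae_filter_eq_bot_iff)
  ultimately obtain x where x: "x \<in> space \<mu>" and
    n: "\<And>n::nat. (\<integral>\<^sup>+y. indicator (mball a (real n)) x * (indicator (mball a (real n)) y * ennreal \<bar>f x - f y\<bar>) \<partial>\<mu>) = 0"
    by (blast dest: eventually_happens')
  have "AE y in \<mu>. \<forall>n::nat. indicator (mball a (real n)) x * (indicator (mball a (real n)) y * ennreal \<bar>f x - f y\<bar>) = 0"
    unfolding AE_all_countable using n by (subst (asm) nn_integral_0_iff_AE) auto
  then have fc: "AE y in \<mu>. f y = f x"
  proof (elim AE_mp, intro AE_I2 impI)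
    fix y assume y: "y \<in> space \<mu>" and
      *: "\<forall>n::nat. indicator (mball a (real n)) x * (indicator (mball a (real n)) y * ennreal \<bar>f x - f y\<bar>) = 0"
    obtain n :: nat where "max (d a x) (d a y) < real n" using reals_Archimedean2 by blast
    then have "x \<in> mball a (real n)" "y \<in> mball a (real n)" using x y a by (auto simp: space_eq)
    then show "f y = f x" using *[rule_format, of n] by simp
  qed
  have "integrable \<mu> (\<lambda>_. f x)"
    by (rule integrable_cong_AE_imp[OF fi]) (use fc in auto)
  then have "ennreal \<bar>f x\<bar> * emeasure \<mu> (space \<mu>) < \<infinity>"
    by (simp add: integrable_iff_bounded)
  then have "f x = 0" using inf by (auto simp: ennreal_mult_top split: if_splits)
  then show ?thesis using fc by simp
qed

text \<open>All members of the class are null functions, so the indicator of a unit ball keeps a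
  distance equal to its positive mass from each of them.\<close>

lemma besov1_not_dense:
  assumes geo: "geodesic_space X d" and sep: "separable_space mtopology"
    and p: "sub_Gaussian_bounds \<mu> d p dH dW" and \<alpha>: "dH / dW < \<alpha>"
    and "X \<noteq> {}"
  shows "\<not> dense_in_L1 \<mu> (besov1 \<mu> p \<alpha>)"
proof
  assume dense: "dense_in_L1 \<mu> (besov1 \<mu> p \<alpha>)"
  obtain a where a: "a \<in> X" using \<open>X \<noteq> {}\<close> by blast
  let ?B = "mball a 1"
  have i: "integrable \<mu> (indicator ?B :: 'a \<Rightarrow> real)"
    using emeasure_mball_finite[of a 1] by (simp add: less_top)
  have "0 < emeasure \<mu> ?B"
  proof -
    obtain c1 where "0 < c1" "\<And>x r. x \<in> X \<Longrightarrow> 0 \<le> r \<Longrightarrow> ennreal (c1 * r powr dH) \<le> emeasure \<mu> (mball x r)"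
      using ball_bounds by metis
    then have "0 < ennreal c1" "ennreal c1 \<le> emeasure \<mu> ?B" using a by (simp, metis powr_one_eq_one mult_1_right zero_le_one)
    then show ?thesis by (rule order_less_le_trans)
  qed
  then have pos: "0 < measure \<mu> ?B"
    using emeasure_mball_finite[of a 1] by (simp add: measure_def enn2real_positive_iff less_top)
  then obtain g where g: "g \<in> besov1 \<mu> p \<alpha>" "(\<integral>x. \<bar>indicator ?B x - g x\<bar> \<partial>\<mu>) < measure \<mu> ?B"
    using dense i unfolding dense_in_L1_def by blast
  have "(\<integral>x. \<bar>indicator ?B x - g x\<bar> \<partial>\<mu>) = (\<integral>x. indicator ?B x \<partial>\<mu>)"
  proof (rule integral_cong_AE)
    have "g \<in> borel_measurable \<mu>" using g by (auto simp: besov1_def)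
    then show "(\<lambda>x. \<bar>indicator ?B x - g x\<bar>) \<in> borel_measurable \<mu>" by measurable
    show "AE x in \<mu>. \<bar>indicator ?B x - g x\<bar> = indicator ?B x"
      using besov1_AE_zero[OF geo sep p g(1) \<alpha> \<open>X \<noteq> {}\<close>] by (elim AE_mp) auto
  qed simp
  also have "\<dots> = measure \<mu> ?B" using sets.sets_into_space[OF mball_sets[of a 1]] by (simp add: Int_absorb2)
  finally show False using g by simp
qed

end

section \<open>The unbounded nested fractal\<close>

text \<open>A geodesic is connected. If it avoided \<open>B\<close>, the open sets
  \<open>C - B\<close> and \<open>M - C\<close> would separate it. At the crossing parameter
  \<open>s\<close> the two distances are \<open>s\<close> and \<open>D - s\<close>.\<close>

lemma (in Metric_space) geodesic_crosses_boundary: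
  assumes geo: "geodesic_space M d" and "openin mtopology (C - B)" and "closedin mtopology C"
    and x: "x \<in> C" and y: "y \<in> M - C"
  shows "\<exists>b\<in>B \<inter> M. d x y = d x b + d b y"
proof -
  have xM: "x \<in> M" "y \<in> M" using assms closedin_subset[of mtopology C] by auto
  define D where "D = d x y"
  obtain \<gamma> where \<gamma>: "\<gamma> ` {0..D} \<subseteq> M" "\<gamma> 0 = x" "\<gamma> D = y"
    "\<And>s t. s \<in> {0..D} \<Longrightarrow> t \<in> {0..D} \<Longrightarrow> d (\<gamma> s) (\<gamma> t) = \<bar>s - t\<bar>"
    using geo xM unfolding geodesic_space_def D_def by meson
  have D0: "0 \<le> D" by (simp add: D_def)
  have "continuous_map (top_of_set {0..D}) mtopology \<gamma>"
    unfolding continuous_map_to_metric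
  proof (intro ballI allI impI)
    fix s and \<epsilon> :: real assume s: "s \<in> topspace (top_of_set {0..D})" and "0 < \<epsilon>"
    show "\<exists>U. openin (top_of_set {0..D}) U \<and> s \<in> U \<and> (\<forall>t\<in>U. \<gamma> t \<in> mball (\<gamma> s) \<epsilon>)"
    proof (intro exI conjI ballI)
      show "openin (top_of_set {0..D}) ({0..D} \<inter> ball s \<epsilon>)" by (simp add: openin_open_Int)
      show "s \<in> {0..D} \<inter> ball s \<epsilon>" using s \<open>0 < \<epsilon>\<close> by simp
      fix t assume "t \<in> {0..D} \<inter> ball s \<epsilon>"
      then show "\<gamma> t \<in> mball (\<gamma> s) \<epsilon>"
        using s \<gamma>(1) \<gamma>(4)[of s t] by (auto simp: dist_real_def)
    qed
  qed
  moreover have "connectedin (top_of_set {0..D}) {0..D}"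
    by (simp add: connectedin_subtopology)
  ultimately have conn: "connectedin mtopology (\<gamma> ` {0..D})"
    by (rule connectedin_continuous_map_image)
  have "\<exists>s\<in>{0..D}. \<gamma> s \<in> B"
  proof (rule ccontr)
    assume no: "\<not> (\<exists>s\<in>{0..D}. \<gamma> s \<in> B)"
    have "openin mtopology (M - C)"
      using assms(3) by (simp add: closedin_def)
    moreover have "\<gamma> ` {0..D} \<subseteq> (C - B) \<union> (M - C)" using no \<gamma>(1) by auto
    moreover have "(C - B) \<inter> (M - C) \<inter> \<gamma> ` {0..D} = {}" by blast
    ultimately have "(C - B) \<inter> \<gamma> ` {0..D} = {} \<or> (M - C) \<inter> \<gamma> ` {0..D} = {}"
      using conn assms(2) unfolding connectedin by blast
    moreover have "x \<in> (C - B) \<inter> \<gamma> ` {0..D}" using no x \<gamma>(2) D0 by force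
    moreover have "y \<in> (M - C) \<inter> \<gamma> ` {0..D}" using y \<gamma>(3) D0 by force
    ultimately show False by blast
  qed
  then obtain s where s: "s \<in> {0..D}" "\<gamma> s \<in> B" by blast
  have "d x (\<gamma> s) = s" "d (\<gamma> s) y = D - s"
    using \<gamma>(4)[of 0 s] \<gamma>(4)[of s D] s D0 \<gamma>(2,3) by auto
  then show ?thesis
    using s \<gamma>(1) by (intro bexI[of _ "\<gamma> s"]) (auto simp: D_def)
qed

context unbounded_nested_fractal_dirichlet_space
begin

sublocale ahlfors_space "unbounded_fractal L K" d \<mu> dH
  using radon ahlfors by unfold_locales (auto simp: radon_measure_def)

lemma fractal_nonempty: "unbounded_fractal L K \<noteq> {}"
  using K_nonempty by (auto simp: unbounded_fractal_def)

lemma geodesic: "geodesic_space (unbounded_fractal L K) d"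
  using fractional by (simp add: fractional_metric_space_def)

lemma separable: "separable_space mtopology"
proof -
  obtain T where "countable T" "T \<subseteq> unbounded_fractal L K" "unbounded_fractal L K \<subseteq> closure T"
    using separable by blast
  then show ?thesis
    unfolding separable_space_def euclidean_topology
    by (intro exI[of _ T]) (auto simp: closure_of_subtopology Int_absorb1)
qed

lemma cell_sets:
  assumes "C \<in> cells M L \<psi> K"
  shows "C \<subseteq> unbounded_fractal L K" "compact C" "C \<in> sets \<mu>" "emeasure \<mu> C < \<infinity>" "closedin mtopology C"
proof -
  show C: "C \<subseteq> unbounded_fractal L K" "compact C"
    using assms cell_subset_fractal compact_cell by (auto simp: cells_def)
  show cl: "closedin mtopology C"
    unfolding euclidean_topology using C compact_imp_closed closed_subset by blast
  then have "openin mtopology (unbounded_fractal L K - C)" by (simp add: closedin_def)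
  then have "space \<mu> - (unbounded_fractal L K - C) \<in> sets \<mu>" using openin_sets by blast
  moreover have "space \<mu> - (unbounded_fractal L K - C) = C" using C by (auto simp: space_eq)
  ultimately show "C \<in> sets \<mu>" by simp
  have "compactin mtopology C"
    unfolding euclidean_topology using C by (simp add: compactin_subtopology)
  then show "emeasure \<mu> C < \<infinity>" using radon by (auto simp: radon_measure_def)
qed

lemma finite_cut_cell:
  assumes C: "C \<in> cells M L \<psi> K"
  shows "finite_cut (indicator C)"
proof -
  obtain m w where w: "set w \<subseteq> {1..M}" "C = cell L \<psi> K m w" using C by (auto simp: cells_def)
  define B where "B = (\<lambda>x. L ^ m *\<^sub>R x) ` word_map \<psi> w ` essential_fixed_points M \<psi>"
  have "finite B" unfolding B_def by (intro finite_imageI finite_essential_fixed_points)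
  have op: "openin mtopology (C - B)"
    unfolding euclidean_topology w(2) B_def by (rule openin_cell_minus_boundary[OF w(1)])
  note cross = geodesic_crosses_boundary[OF geodesic op cell_sets(5)[OF C]]
  show ?thesis
    unfolding finite_cut_def
  proof (intro conjI exI ballI impI)
    show "\<bar>indicator C x\<bar> \<le> (1 :: real)" for x by (simp add: indicator_def)
    \<comment> \<open>The vertices are given as points of the ambient space; a crossing point lies
      on a geodesic and hence in the fractal.\<close>
    show "finite (B \<inter> unbounded_fractal L K)" "B \<inter> unbounded_fractal L K \<subseteq> unbounded_fractal L K"
      using \<open>finite B\<close> by auto
    fix x y assume xy: "x \<in> unbounded_fractal L K" "y \<in> unbounded_fractal L K"
      "indicator C x \<noteq> (indicator C y :: real)"
    then consider "x \<in> C" "y \<notin> C" | "y \<in> C" "x \<notin> C" by (cases "x \<in> C"; cases "y \<in> C") auto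
    then show "\<exists>b\<in>B \<inter> unbounded_fractal L K. d x y = d x b + d b y"
    proof cases
      case 1
      then show ?thesis using cross[of x y] xy by blast
    next
      case 2
      then show ?thesis using cross[of y x] xy by (metis DiffI add.commute commute)
    qed
  qed
qed

lemma indicator_cell_besov1:
  assumes C: "C \<in> cells M L \<psi> K"
  shows "(indicator C :: 'a \<Rightarrow> real) \<in> besov1 \<mu> p (dH / dW)"
  using cell_sets[OF C] by (intro finite_cut_besov1 finite_cut_cell C heat_kernel_bounds) (auto simp: less_top)

lemma dense_besov1: "dense_in_L1 \<mu> (besov1 \<mu> p (dH / dW))"
  unfolding dense_in_L1_def
proof (intro allI impI)
  fix f :: "'a \<Rightarrow> real" and \<epsilon> :: real assume f: "integrable \<mu> f" and "0 < \<epsilon>"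
  have "\<exists>g. integrable \<mu> g \<and> finite_cut g \<and> (\<integral>x. \<bar>f x - g x\<bar> \<partial>\<mu>) < \<epsilon>"
  proof (rule finite_cut_approx[where \<C> = "cells M L \<psi> K"])
    show "emeasure \<mu> A = (INF U\<in>{U. openin mtopology U \<and> A \<subseteq> U}. emeasure \<mu> U)" if "A \<in> sets \<mu>" for A
      using radon that by (simp add: radon_measure_def)
    show "\<exists>C\<in>cells M L \<psi> K. x \<in> C \<and> C \<subseteq> U" if U: "openin mtopology U" "x \<in> U" for U x
    proof -
      obtain e where e: "0 < e" "\<And>y. y \<in> unbounded_fractal L K \<Longrightarrow> dist y x < e \<Longrightarrow> y \<in> U"
        using U unfolding euclidean_topology openin_euclidean_subtopology_iff by blast
      have x: "x \<in> unbounded_fractal L K" using openin_subset[OF U(1)] U(2) by auto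
      obtain C where C: "C \<in> cells M L \<psi> K" "x \<in> C" "C \<subseteq> ball x e"
        using small_cell_ex[OF x e(1)] by blast
      have "C \<subseteq> U"
        using C(3) cell_sets(1)[OF C(1)] e(2) by (auto simp: subset_iff dist_commute)
      then show ?thesis using C by blast
    qed
  qed (use f \<open>0 < \<epsilon>\<close> countable_cells cell_sets(3) finite_cut_cell in auto)
  then show "\<exists>g\<in>besov1 \<mu> p (dH / dW). integrable \<mu> g \<and> (\<integral>x. \<bar>f x - g x\<bar> \<partial>\<mu>) < \<epsilon>"
    using finite_cut_besov1[OF _ _ heat_kernel_bounds] by blast
qed

lemma critical_exponent1_eq: "critical_exponent1 \<mu> p = ereal (dH / dW)"
  unfolding critical_exponent1_def
proof (rule antisym)
  show "Sup (ereal ` {\<alpha>. 0 < \<alpha> \<and> dense_in_L1 \<mu> (besov1 \<mu> p \<alpha>)}) \<le> ereal (dH / dW)"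
  proof (rule Sup_least)
    fix e assume "e \<in> ereal ` {\<alpha>. 0 < \<alpha> \<and> dense_in_L1 \<mu> (besov1 \<mu> p \<alpha>)}"
    then obtain \<alpha> where "e = ereal \<alpha>" "dense_in_L1 \<mu> (besov1 \<mu> p \<alpha>)" by blast
    then show "e \<le> ereal (dH / dW)"
      using besov1_not_dense[OF geodesic separable heat_kernel_bounds _ fractal_nonempty] by force
  qed
  \<comment> \<open>The supremum ranges over positive exponents, so positivity is needed for dH / dW
    to belong to the set; the supremum is then attained there.\<close>
  have "0 < dH / dW" using dH_ge_1 dH_less_dW by simp
  then show "ereal (dH / dW) \<le> Sup (ereal ` {\<alpha>. 0 < \<alpha> \<and> dense_in_L1 \<mu> (besov1 \<mu> p \<alpha>)})"
    using dense_besov1 by (intro Sup_upper) blast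
qed

end

theorem theorem5p1:
  fixes M :: nat and L :: real and \<psi> :: "nat \<Rightarrow> 'a::euclidean_space \<Rightarrow> 'a" and K :: "'a set"
    and d :: "'a \<Rightarrow> 'a \<Rightarrow> real" and \<mu> :: "'a measure"
    and \<E> :: "('a \<Rightarrow> real) \<Rightarrow> ('a \<Rightarrow> real) \<Rightarrow> real" and \<F> :: "('a \<Rightarrow> real) set"
    and P :: "real \<Rightarrow> ('a \<Rightarrow> real) \<Rightarrow> ('a \<Rightarrow> real)"
    and p :: "real \<Rightarrow> 'a \<Rightarrow> 'a \<Rightarrow> real" and dH dW :: real
  assumes "unbounded_nested_fractal_dirichlet_space M L \<psi> K d \<mu> \<E> \<F> P p dH dW"
  shows "(\<forall>C\<in>cells M L \<psi> K. (indicator C :: 'a \<Rightarrow> real) \<in> besov1 \<mu> p (dH / dW)) \<and>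
         dense_in_L1 \<mu> (besov1 \<mu> p (dH / dW)) \<and>
         critical_exponent1 \<mu> p = ereal (dH / dW)"
proof -
  interpret unbounded_nested_fractal_dirichlet_space M L \<psi> K d \<mu> \<E> \<F> P p dH dW
    by fact
  show ?thesis
    using indicator_cell_besov1 dense_besov1 critical_exponent1_eq by blast
qed

end
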